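(* Let $\Omega\subseteq\mathbb{R}^n$ be a closed convex set, let $\hat\alpha,\hat\beta$ be probability distributions on $\Omega$ such that $\hat\gamma=\frac12\hat\alpha+\frac12\hat\beta$ is a finite mixture of Diracs, and let $k\colon\Omega^2\to\mathbb{R}$ be a symmetric positive semi-definite kernel with $k\in L^2(\Omega^2)$. Let $\mathcal{L}_{\hat\alpha}(f)=\mathbb{E}_{x\sim\hat\alpha}[f(x)]-\mathbb{E}_{y\sim\hat\beta}[f(y)]$. Then the solutions $f_\cdot\colon\mathbb{R}_+\to L^2(\Omega)$ of $\partial_t f_t=\mathcal{T}_{k,\hat\gamma}(\nabla^{\hat\gamma}\mathcal{L}_{\hat\alpha}(f_t))$ are the functions of the form $f_t=f_0+tf^\ast_{\hat\alpha}$ (with $f_0\in L^2(\Omega)$), where $f^\ast_{\hat\alpha}$ is the unnormalized MMD witness function $$f^\ast_{\hat\alpha}=\mathbb{E}_{x\sim\hat\alpha}[k(x,\cdot)]-\mathbb{E}_{y\sim\hat\beta}[k(y,\cdot)],$$ and $$\mathcal{L}_{\hat\alpha}(f_t)=\mathcal{L}_{\hat\alpha}(f_0)+t\cdot\mathrm{MMD}_k^2(\hat\alpha,\hat\beta).$$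
   Context: $L^2(\Omega)$ is taken with respect to Lebesgue measure on $\Omega$; its elements, and $k$, are treated as genuine everywhere-defined functions. For a finite mixture of Diracs $\mu$, $L^2(\mu)$ is the space of functions $\operatorname{supp}\mu\to\mathbb{R}$ with scalar product $\langle h,h'\rangle_{L^2(\mu)}=\int hh'\,d\mu$. $\nabla^{\mu}\mathcal{L}(f)\in L^2(\mu)$ is the element such that $\lim_{\varepsilon\to0}\frac1\varepsilon(\mathcal{L}(f+\varepsilon\psi)-\mathcal{L}(f))=\langle\nabla^{\mu}\mathcal{L}(f),\psi\rangle_{L^2(\mu)}$ for all $\psi\in L^2(\mu)$; for $f\in L^2(\Omega)$, $\nabla^{\hat\gamma}\mathcal{L}_{\hat\alpha}(f)$ means $\nabla^{\hat\gamma}\mathcal{L}_{\hat\alpha}(f|_{\operatorname{supp}\hat\gamma})$. $\mathcal{T}_{k,\mu}(h)=\int_x k(\cdot,x)h(x)\,d\mu(x)$ for $h\in L^2(\mu)$. The differential equation is understood pointwise on $\Omega$. The squared maximum mean discrepancy is $\mathrm{MMD}_k^2(\hat\alpha,\hat\beta)=\mathbb{E}_{x,x'\sim\hat\alpha}[k(x,x')]-2\mathbb{E}_{x\sim\hat\alpha,y\sim\hat\beta}[k(x,y)]+\mathbb{E}_{y,y'\sim\hat\beta}[k(y,y')]$ (independent pairs). *)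

theory Defs
  imports "HOL-Probability.Probability"
begin

text \<open>
  A function with domain \<open>A\<close> is represented by an element of \<^term>\<open>extensional A\<close>, so that
  equality of HOL functions is equality at every point of \<open>A\<close>.  No identification of functions
  that agree almost everywhere takes place.
\<close>

definition L2 :: "'a::euclidean_space set \<Rightarrow> ('a \<Rightarrow> real) set" where
  "L2 A = {f \<in> extensional A. f \<in> borel_measurable (lebesgue_on A) \<and>
                               integrable (lebesgue_on A) (\<lambda>x. (f x)\<^sup>2)}"

definition distribution_on :: "'a::topological_space set \<Rightarrow> 'a measure \<Rightarrow> bool" where
  "distribution_on A \<mu> \<longleftrightarrow> prob_space \<mu> \<and> sets \<mu> = sets (restrict_space borel A)"

definition half_mixture :: "'a measure \<Rightarrow> 'a measure \<Rightarrow> 'a measure" where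
  "half_mixture \<alpha> \<beta> =
     measure_of (space \<alpha>) (sets \<alpha>) (\<lambda>A. (1/2) * emeasure \<alpha> A + (1/2) * emeasure \<beta> A)"

definition finite_dirac_mixture :: "'a measure \<Rightarrow> bool" where
  "finite_dirac_mixture \<mu> \<longleftrightarrow>
     (\<exists>S w. finite S \<and> S \<subseteq> space \<mu> \<and> (\<forall>x\<in>S. 0 \<le> w x) \<and> (\<Sum>x\<in>S. w x) = (1::real) \<and>
        (\<forall>A\<in>sets \<mu>. emeasure \<mu> A = (\<Sum>x\<in>S. ennreal (w x) * emeasure (return \<mu> x) A)))"

definition supp :: "'a::topological_space measure \<Rightarrow> 'a set" where
  "supp \<mu> = {x \<in> space \<mu>. \<forall>U. open U \<longrightarrow> x \<in> U \<longrightarrow> 0 < emeasure \<mu> (U \<inter> space \<mu>)}"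

text \<open>
  Integrals are taken with respect to the completion of \<open>\<mu>\<close>: elements of \<^term>\<open>L2 A\<close> and
  sections of a kernel need not be Borel measurable, and the Bochner integral of a
  non-measurable function is \<open>0\<close> by convention.  If \<open>\<mu>\<close> is a Borel measure that is a finite mixture
  of Diracs, every function is measurable for the completion, and its integral is the
  weighted sum of its values at the atoms.
\<close>

definition expect :: "'a measure \<Rightarrow> ('a \<Rightarrow> real) \<Rightarrow> real" where
  "expect \<mu> h = (\<integral>x. h x \<partial>(completion \<mu>))"

definition L2_discrete :: "'a::topological_space measure \<Rightarrow> ('a \<Rightarrow> real) set" where
  "L2_discrete \<mu> = extensional (supp \<mu>)"

definition L2_inner :: "'a measure \<Rightarrow> ('a \<Rightarrow> real) \<Rightarrow> ('a \<Rightarrow> real) \<Rightarrow> real" where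
  "L2_inner \<mu> g h = expect \<mu> (\<lambda>x. g x * h x)"

definition L2_gradient ::
    "'a::topological_space measure \<Rightarrow> (('a \<Rightarrow> real) \<Rightarrow> real) \<Rightarrow> ('a \<Rightarrow> real) \<Rightarrow> 'a \<Rightarrow> real" where
  "L2_gradient \<mu> L f =
     (THE g. g \<in> L2_discrete \<mu> \<and>
        (\<forall>\<psi>\<in>L2_discrete \<mu>.
           ((\<lambda>\<epsilon>. (1 / \<epsilon>) * (L (\<lambda>x\<in>supp \<mu>. f x + \<epsilon> * \<psi> x) - L f))
              \<longlongrightarrow> L2_inner \<mu> g \<psi>) (at 0)))"

definition symmetric_kernel :: "'a set \<Rightarrow> ('a \<Rightarrow> 'a \<Rightarrow> real) \<Rightarrow> bool" where
  "symmetric_kernel A k \<longleftrightarrow> (\<forall>x\<in>A. \<forall>y\<in>A. k x y = k y x)"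

definition pos_semidef_kernel :: "'a set \<Rightarrow> ('a \<Rightarrow> 'a \<Rightarrow> real) \<Rightarrow> bool" where
  "pos_semidef_kernel A k \<longleftrightarrow>
     (\<forall>S c. finite S \<longrightarrow> S \<subseteq> A \<longrightarrow> 0 \<le> (\<Sum>x\<in>S. \<Sum>y\<in>S. c x * c y * k x y))"

definition kernel_operator ::
    "'a set \<Rightarrow> ('a \<Rightarrow> 'a \<Rightarrow> real) \<Rightarrow> 'a measure \<Rightarrow> ('a \<Rightarrow> real) \<Rightarrow> 'a \<Rightarrow> real" where
  "kernel_operator A k \<mu> h = (\<lambda>y\<in>A. expect \<mu> (\<lambda>x. k y x * h x))"

definition ipm_loss :: "'a measure \<Rightarrow> 'a measure \<Rightarrow> ('a \<Rightarrow> real) \<Rightarrow> real" where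
  "ipm_loss \<alpha> \<beta> f = expect \<alpha> f - expect \<beta> f"

text \<open>At \<open>t = 0\<close> the time derivative is one-sided.  Values at negative times play no role.\<close>

definition kernel_flow_solution ::
    "'a::euclidean_space set \<Rightarrow> ('a \<Rightarrow> 'a \<Rightarrow> real) \<Rightarrow> 'a measure \<Rightarrow> (('a \<Rightarrow> real) \<Rightarrow> real)
       \<Rightarrow> (real \<Rightarrow> 'a \<Rightarrow> real) \<Rightarrow> bool" where
  "kernel_flow_solution A k \<mu> L f \<longleftrightarrow>
     (\<forall>t\<ge>0. f t \<in> L2 A) \<and>
     (\<forall>t\<ge>0. \<forall>x\<in>A.
        ((\<lambda>s. f s x) has_real_derivative
           kernel_operator A k \<mu> (L2_gradient \<mu> L (restrict (f t) (supp \<mu>))) x)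
          (at t within {0..}))"

definition mmd_witness ::
    "'a set \<Rightarrow> ('a \<Rightarrow> 'a \<Rightarrow> real) \<Rightarrow> 'a measure \<Rightarrow> 'a measure \<Rightarrow> 'a \<Rightarrow> real" where
  "mmd_witness A k \<alpha> \<beta> = (\<lambda>z\<in>A. expect \<alpha> (\<lambda>x. k x z) - expect \<beta> (\<lambda>y. k y z))"

definition mmd_squared :: "('a \<Rightarrow> 'a \<Rightarrow> real) \<Rightarrow> 'a measure \<Rightarrow> 'a measure \<Rightarrow> real" where
  "mmd_squared k \<alpha> \<beta> =
     expect (\<alpha> \<Otimes>\<^sub>M \<alpha>) (\<lambda>(x, x'). k x x') -
     2 * expect (\<alpha> \<Otimes>\<^sub>M \<beta>) (\<lambda>(x, y). k x y) +
     expect (\<beta> \<Otimes>\<^sub>M \<beta>) (\<lambda>(y, y'). k y y')"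

end

theory Submission imports Defs
begin

text \<open>
  Along the flow the loss gradient does not depend on \<open>f\<close>, so the drift is the constant
  \<open>f\<^sup>*\<close> and everything except \<open>f\<^sup>* \<in> L\<^sup>2(\<Omega>)\<close> is a computation with finite sums.  That
  membership needs every section \<open>k(z, \<cdot>)\<close>, not just almost every one, to be square integrable.
  In terms of the feature map \<open>\<Phi>\<close> of \<open>k\<close>: if \<open>f\<close> is bounded and supported in a bounded set on which
  the (possibly non-measurable) diagonal is bounded, then \<open>u \<mapsto> \<integral> f \<langle>u, \<Phi>\<rangle>\<close> is a bounded functional
  of squared norm at most \<open>\<integral>\<integral> f(x) k(x, y) f(y) \<le> \<parallel>k\<parallel> \<parallel>f\<parallel>\<^sup>2\<close>.  Evaluating it at \<open>\<Phi>(z)\<close> for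
  \<open>f\<close> a truncation of \<open>k(z, \<cdot>)\<close> gives \<open>\<parallel>f\<parallel>\<^sup>2 \<le> k(z, z) \<parallel>k\<parallel>\<close>, uniformly in the truncation.
\<close>

subsection \<open>Formal combinations and approximate representers\<close>

text \<open>The value at the minimiser \<open>t = - a / b\<close> is
  \<open>(d * b - a\<^sup>2) / b\<close>. If \<open>b = 0\<close>, an affine function bounded below
  is constant, hence \<open>a = 0\<close>. Besides Cauchy-Schwarz, this turns near-minimality along
  lines into an error estimate.\<close>

lemma quadratic_nonneg_discriminant:
  fixes a b d :: real
  assumes nonneg: "\<And>t. 0 \<le> d + 2 * t * a + t\<^sup>2 * b" and "0 \<le> b"
  shows "a\<^sup>2 \<le> d * b"
proof (cases "b = 0")
  case True
  have "a = 0"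
  proof (rule ccontr)
    assume "a \<noteq> 0"
    \<comment> \<open>At this \<open>t\<close> the left side of \<open>nonneg\<close> would be
      -1.\<close>
    with nonneg[of "- (d + 1) / (2 * a)"] True show False by (simp add: field_simps)
  qed
  then show ?thesis using True by simp
next
  case False
  then have "0 < b" using assms(2) by simp
  have "0 \<le> b * (d + 2 * (- a / b) * a + (- a / b)\<^sup>2 * b)"
    using nonneg[of "- a / b"] \<open>0 < b\<close> by simp
  also have "\<dots> = d * b - a\<^sup>2"
    using \<open>0 < b\<close> by (simp add: field_simps power2_eq_square)
  finally show ?thesis by simp
qed

lemma integrable_mult_square_integrable:
  fixes f g :: "'a \<Rightarrow> real"
  assumes [measurable]: "f \<in> borel_measurable M" "g \<in> borel_measurable M"
    and "integrable M (\<lambda>x. (f x)\<^sup>2)" "integrable M (\<lambda>x. (g x)\<^sup>2)"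
  shows "integrable M (\<lambda>x. f x * g x)"
proof (rule Bochner_Integration.integrable_bound)
  show "integrable M (\<lambda>x. (f x)\<^sup>2 + (g x)\<^sup>2)" using assms by simp
  have "\<bar>f x * g x\<bar> \<le> (f x)\<^sup>2 + (g x)\<^sup>2" for x
    using sum_squares_bound[of "\<bar>f x\<bar>" "\<bar>g x\<bar>"] mult_nonneg_nonneg[OF abs_ge_zero abs_ge_zero, of "f x" "g x"]
    unfolding abs_mult power2_abs by linarith
  then show "AE x in M. norm (f x * g x) \<le> norm ((f x)\<^sup>2 + (g x)\<^sup>2)"
    by (auto intro!: AE_I2)
qed measurable

lemma Cauchy_Schwarz_integral:
  fixes f g :: "'a \<Rightarrow> real"
  assumes "f \<in> borel_measurable M" "g \<in> borel_measurable M"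
    and "integrable M (\<lambda>x. (f x)\<^sup>2)" "integrable M (\<lambda>x. (g x)\<^sup>2)"
  shows "(\<integral>x. f x * g x \<partial>M)\<^sup>2 \<le> (\<integral>x. (f x)\<^sup>2 \<partial>M) * (\<integral>x. (g x)\<^sup>2 \<partial>M)"
proof (rule quadratic_nonneg_discriminant)
  fix t :: real
  note fg = integrable_mult_square_integrable[OF assms]
  have "0 \<le> (\<integral>x. (f x + t * g x)\<^sup>2 \<partial>M)" by simp
  also have "(\<lambda>x. (f x + t * g x)\<^sup>2) =
      (\<lambda>x. (f x)\<^sup>2 + 2 * t * (f x * g x) + t\<^sup>2 * (g x)\<^sup>2)"
    by (simp add: power2_eq_square algebra_simps)
  also have "(\<integral>x. (f x)\<^sup>2 + 2 * t * (f x * g x) + t\<^sup>2 * (g x)\<^sup>2 \<partial>M) =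
      (\<integral>x. (f x)\<^sup>2 \<partial>M) + 2 * t * (\<integral>x. f x * g x \<partial>M) + t\<^sup>2 * (\<integral>x. (g x)\<^sup>2 \<partial>M)"
    using assms fg by simp
  finally show "0 \<le> \<dots>" .
qed simp

text \<open>The rate \<open>1 / (n + 1)\<close> is that of \<open>approximate_representer\<close>,
  whose squared errors become limits in this way.\<close>

lemma tendsto_zero_if_squares_le:
  fixes a :: "nat \<Rightarrow> real"
  assumes "\<And>n. (a n)\<^sup>2 \<le> 1 / real (Suc n) * b"
  shows "a \<longlonglongrightarrow> 0"
proof -
  have "(\<lambda>n. (a n)\<^sup>2) \<longlonglongrightarrow> 0"
  proof (rule tendsto_sandwich[OF _ _ tendsto_const])
    show "(\<lambda>n. 1 / real (Suc n) * b) \<longlonglongrightarrow> 0"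
      using tendsto_mult[OF LIMSEQ_Suc[OF lim_inverse_n'] tendsto_const[of b]] by simp
    show "\<forall>\<^sub>F n in sequentially. (a n)\<^sup>2 \<le> 1 / real (Suc n) * b"
      using assms by (intro always_eventually allI)
  qed simp
  then show ?thesis
    using tendsto_real_sqrt[of _ 0 sequentially] by (fastforce simp: tendsto_rabs_zero_iff)
qed

text \<open>A list stands for the vector \<open>\<Sum> a \<Phi>(x)\<close> in the span of the
  feature vectors, and \<open>lincomb u g\<close> is the linear extension of \<open>g\<close> to it.
  Repeated points are allowed, so that addition is appending.\<close>

definition lincomb :: "(real \<times> 'a) list \<Rightarrow> ('a \<Rightarrow> real) \<Rightarrow> real" where
  "lincomb u g = (\<Sum>(a, x)\<leftarrow>u. a * g x)"

definition scale_comb :: "real \<Rightarrow> (real \<times> 'a) list \<Rightarrow> (real \<times> 'a) list" where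
  "scale_comb t u = map (\<lambda>(a, x). (t * a, x)) u"

lemma lincomb_Nil [simp]: "lincomb [] g = 0"
  and lincomb_Cons [simp]: "lincomb ((a, x) # u) g = a * g x + lincomb u g"
  and lincomb_append [simp]: "lincomb (u @ v) g = lincomb u g + lincomb v g"
  by (simp_all add: lincomb_def)

lemma lincomb_scale [simp]: "lincomb (scale_comb t u) g = t * lincomb u g"
  by (induction u) (auto simp: scale_comb_def lincomb_def algebra_simps)

lemma snd_set_scale [simp]: "snd ` set (scale_comb t u) = snd ` set u"
  by (force simp: scale_comb_def image_iff)

lemma lincomb_add: "lincomb u (\<lambda>x. g x + h x) = lincomb u g + lincomb u h"
  by (induction u) (auto simp: algebra_simps)

lemma lincomb_mult: "lincomb u (\<lambda>x. t * g x) = t * lincomb u g"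
  by (induction u) (auto simp: algebra_simps)

lemma lincomb_swap: "lincomb u (\<lambda>x. lincomb v (g x)) = lincomb v (\<lambda>y. lincomb u (\<lambda>x. g x y))"
proof (induction u)
  case Nil
  then show ?case by (induction v) auto
next
  case (Cons p u)
  then show ?case by (cases p) (simp add: lincomb_add lincomb_mult)
qed

lemma borel_measurable_lincomb [measurable (raw)]:
  assumes "\<And>x. x \<in> snd ` set u \<Longrightarrow> (\<lambda>y. g y x) \<in> borel_measurable M"
  shows "(\<lambda>y. lincomb u (g y)) \<in> borel_measurable M"
  using assms by (induction u) auto

text \<open>Collects repeated points: the inner \<open>lincomb\<close> is the total coefficient of
  \<open>x\<close>. This links lists to \<open>pos_semidef_kernel\<close>, whose sums run over
  finite sets.\<close>

lemma lincomb_eq_sum: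
  assumes "finite S" "snd ` set u \<subseteq> S"
  shows "lincomb u g = (\<Sum>x\<in>S. lincomb u (\<lambda>y. of_bool (y = x)) * g x)"
  using assms(2)
proof (induction u)
  case Nil
  then show ?case by simp
next
  case (Cons p u)
  obtain a x where p: "p = (a, x)" by fastforce
  have "lincomb (p # u) (\<lambda>y. of_bool (y = z)) * g z =
      (if z = x then a * g x else 0) + lincomb u (\<lambda>y. of_bool (y = z)) * g z" for z
    by (simp add: p distrib_right)
  then have "(\<Sum>z\<in>S. lincomb (p # u) (\<lambda>y. of_bool (y = z)) * g z) =
      (\<Sum>z\<in>S. if z = x then a * g x else 0) + lincomb u g"
    using Cons by (simp add: sum.distrib)
  then show ?case using Cons p assms(1) by simp
qed

section \<open>The Gram form of a positive semidefinite kernel\<close>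

locale psd_kernel =
  fixes K :: "'a \<Rightarrow> 'a \<Rightarrow> real"
  assumes symmetric: "symmetric_kernel UNIV K" and psd: "pos_semidef_kernel UNIV K"
begin

text \<open>The inner product of the two vectors in feature space. As a form on lists it may
  degenerate, since different lists can represent the same vector.\<close>

definition gram :: "(real \<times> 'a) list \<Rightarrow> (real \<times> 'a) list \<Rightarrow> real" where
  "gram u v = lincomb u (\<lambda>x. lincomb v (K x))"

lemma kernel_sym: "K x y = K y x"
  using symmetric by (simp add: symmetric_kernel_def)

lemma gram_commute: "gram u v = gram v u"
  unfolding gram_def by (subst lincomb_swap) (simp only: kernel_sym)

lemma gram_append [simp]: "gram (u @ w) v = gram u v + gram w v"
  and gram_scale [simp]: "gram (scale_comb t u) v = t * gram u v"
  by (simp_all add: gram_def)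

lemma gram_append_right [simp]: "gram v (u @ w) = gram v u + gram v w"
  and gram_scale_right [simp]: "gram v (scale_comb t u) = t * gram v u"
  by (simp_all only: gram_commute[of v "u @ w"] gram_commute[of v "scale_comb t u"]
      gram_append gram_scale gram_commute[of u v] gram_commute[of w v])

text \<open>Reproducing property: \<open>[(1, y)]\<close> stands for \<open>\<Phi>(y)\<close>, and
  pairing with it evaluates at \<open>y\<close> the function that \<open>u\<close>
  represents.\<close>

lemma gram_single: "gram u [(1, y)] = lincomb u (\<lambda>x. K x y)"
  and gram_single': "gram [(1, x)] [(1, y)] = K x y"
  by (simp_all add: gram_def)

lemma gram_nonneg: "0 \<le> gram u u"
proof -
  let ?S = "snd ` set u" and ?c = "\<lambda>x. lincomb u (\<lambda>y. of_bool (y = x))"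
  have "gram u u = (\<Sum>x\<in>?S. ?c x * lincomb u (K x))"
    unfolding gram_def by (rule lincomb_eq_sum) auto
  also have "\<dots> = (\<Sum>x\<in>?S. \<Sum>y\<in>?S. ?c x * ?c y * K x y)"
    by (subst (2) lincomb_eq_sum[of ?S]) (auto simp: sum_distrib_left mult.assoc)
  also have "\<dots> \<ge> 0"
    using psd[unfolded pos_semidef_kernel_def, rule_format, of ?S] by simp
  finally show ?thesis .
qed

lemma diag_nonneg: "0 \<le> K x x"
  using gram_nonneg[of "[(1, x)]"] by (simp add: gram_single')

lemma gram_Cauchy_Schwarz: "(gram u v)\<^sup>2 \<le> gram u u * gram v v"
proof (rule quadratic_nonneg_discriminant)
  show "0 \<le> gram u u + 2 * t * gram u v + t\<^sup>2 * gram v v" for t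
    using gram_nonneg[of "u @ scale_comb t v"]
    by (simp add: gram_commute[of v u] algebra_simps power2_eq_square)
qed (rule gram_nonneg)

text \<open>
  A replacement for the Riesz representation theorem that does not need the completion of the
  span of the feature vectors: \<open>u n\<close> minimises \<open>gram u u - 2 * lincomb u \<tau>\<close> up to \<open>1 / (n + 1)\<close>.
\<close>

lemma approximate_representer:
  assumes bounded: "\<And>u. snd ` set u \<subseteq> G \<Longrightarrow> (lincomb u \<tau>)\<^sup>2 \<le> C * gram u u" and "0 \<le> C"
  obtains U :: "nat \<Rightarrow> (real \<times> 'a) list"
  where "\<And>n. snd ` set (U n) \<subseteq> G"
    and "\<And>n (v :: (real \<times> 'a) list). snd ` set v \<subseteq> G \<Longrightarrow>
           (gram (U n) v - lincomb v \<tau>)\<^sup>2 \<le> 1 / real (Suc n) * gram v v"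
proof -
  define J where "J u = gram u u - 2 * lincomb u \<tau>" for u
  define D where "D = {u :: (real \<times> 'a) list. snd ` set u \<subseteq> G}"
  have lower: "- C \<le> J u" if "u \<in> D" for u
  proof -
    have "(2 * lincomb u \<tau>)\<^sup>2 \<le> 4 * (C * gram u u)"
      using bounded[of u] that by (simp add: D_def power_mult_distrib)
    \<comment> \<open>AM-GM. It yields the lower bound that makes the infimum of \<open>J\<close>
      over \<open>D\<close> finite.\<close>
    also have "\<dots> \<le> (C + gram u u)\<^sup>2"
      using zero_le_power2[of "C - gram u u"] by (simp add: power2_eq_square algebra_simps)
    finally have "2 * lincomb u \<tau> \<le> C + gram u u"
      using \<open>0 \<le> C\<close> gram_nonneg[of u] by (auto intro: power2_le_imp_le[of "2 * lincomb u \<tau>"])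
    then show ?thesis by (simp add: J_def)
  qed
  then have bdd: "bdd_below (J ` D)" by (intro bdd_belowI2[of _ "- C"]) auto
  have "[] \<in> D" by (simp add: D_def)
  have "\<exists>u\<in>D. J u < Inf (J ` D) + 1 / real (Suc n)" for n
    using cInf_lessD[of "J ` D" "Inf (J ` D) + 1 / real (Suc n)"] \<open>[] \<in> D\<close> by auto
  then obtain U where U: "\<And>n. U n \<in> D" "\<And>n. J (U n) < Inf (J ` D) + 1 / real (Suc n)"
    by metis
  show thesis
  proof
    show "snd ` set (U n) \<subseteq> G" for n using U(1)[of n] by (simp add: D_def)
    fix n and v :: "(real \<times> 'a) list" assume v: "snd ` set v \<subseteq> G"
    show "(gram (U n) v - lincomb v \<tau>)\<^sup>2 \<le> 1 / real (Suc n) * gram v v"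
    \<comment> \<open>Adding \<open>t\<close> times \<open>v\<close> to \<open>U n\<close> lowers
      \<open>J\<close> by at most \<open>1 / (n + 1)\<close>, for every \<open>t\<close>. The
      discriminant of this quadratic in \<open>t\<close> is the estimate.\<close>
    proof (rule quadratic_nonneg_discriminant)
      fix t :: real
      have "U n @ scale_comb t v \<in> D"
        using U(1)[of n] v snd_set_scale[of t v] by (auto simp: D_def image_Un)
      then have "Inf (J ` D) \<le> J (U n @ scale_comb t v)"
        by (intro cInf_lower bdd) auto
      moreover have "J (U n @ scale_comb t v) =
          J (U n) + 2 * t * (gram (U n) v - lincomb v \<tau>) + t\<^sup>2 * gram v v"
        by (simp add: J_def gram_commute[of v "U n"] algebra_simps power2_eq_square)
      ultimately show "0 \<le> 1 / real (Suc n) + 2 * t * (gram (U n) v - lincomb v \<tau>) + t\<^sup>2 * gram v v"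
        using U(2)[of n] by linarith
    qed (rule gram_nonneg)
  qed
qed

end

subsection \<open>Sections of a square integrable kernel\<close>

text \<open>Measurability refers to the completed measure on the product. Hence Fubini speaks about
  almost every section only, while the sections wanted later are those at finitely many atoms, a
  null set.\<close>

locale square_integrable_psd_kernel = psd_kernel K
  for K :: "'a::euclidean_space \<Rightarrow> 'a \<Rightarrow> real" +
  assumes kernel_measurable: "(\<lambda>p. K (fst p) (snd p)) \<in> borel_measurable lebesgue"
    and kernel_square_integrable: "integrable lebesgue (\<lambda>p. (K (fst p) (snd p))\<^sup>2)"
begin

text \<open>The squared Hilbert-Schmidt norm: its square root bounds the operator norm of the
  integral operator with kernel \<open>K\<close>.\<close>

definition kernel_energy :: real where
  "kernel_energy = (\<integral>p. (K (fst p) (snd p))\<^sup>2 \<partial>lebesgue)"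

lemma kernel_energy_nonneg: "0 \<le> kernel_energy"
  by (simp add: kernel_energy_def)

text \<open>Fubini is applied to a Borel function \<open>g\<close> that agrees with \<open>K\<close>
  almost everywhere, and \<open>N x\<close> is the squared norm of the section of \<open>g\<close>
  at \<open>x\<close>. Almost every section of \<open>K\<close> agrees almost everywhere with that
  of \<open>g\<close> and inherits its properties by completeness.\<close>

lemma AE_section_square_integrable:
  obtains N :: "'a \<Rightarrow> real"
  where "integrable lebesgue N" "(\<integral>x. N x \<partial>lebesgue) = kernel_energy"
    "AE x in lebesgue. K x \<in> borel_measurable lebesgue"
    "AE x in lebesgue. K x \<in> borel_measurable lebesgue \<longrightarrow>
       integrable lebesgue (\<lambda>y. (K x y)\<^sup>2) \<and> (\<integral>y. (K x y)\<^sup>2 \<partial>lebesgue) = N x"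
proof -
  obtain g :: "'a \<times> 'a \<Rightarrow> real" where g_lborel: "g \<in> borel_measurable lborel"
    and g: "AE p in lborel. K (fst p) (snd p) = g p"
    using completion_ex_borel_measurable_real[OF kernel_measurable] by blast
  have g_meas [measurable]: "g \<in> borel_measurable (lborel \<Otimes>\<^sub>M lborel)"
    using g_lborel by (simp only: lborel_prod)
  have sq_eq: "AE p in lebesgue. (K (fst p) (snd p))\<^sup>2 = (g p)\<^sup>2"
    using AE_completion[OF g] by eventually_elim simp
  have "integrable lebesgue (\<lambda>p. (g p)\<^sup>2)"
    by (rule iffD1[OF integrable_cong_AE[OF _ _ sq_eq] kernel_square_integrable])
       (intro borel_measurable_power kernel_measurable measurable_completion[OF g_lborel])+
  then have "integrable lborel (\<lambda>p. (g p)\<^sup>2)"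
    using integrable_completion[OF borel_measurable_power[OF g_lborel]] by blast
  then have g2: "integrable (lborel \<Otimes>\<^sub>M lborel) (\<lambda>p. (g p)\<^sup>2)"
    by (simp only: lborel_prod)
  define N where "N x = (\<integral>y. (g (x, y))\<^sup>2 \<partial>lborel)" for x
  have eq: "AE x in lborel. AE y in lborel. K x y = g (x, y)"
    using lborel_pair.AE_pair[of "\<lambda>p. K (fst p) (snd p) = g p", unfolded lborel_prod, OF g] by simp
  have section_meas: "(\<lambda>y. g (x, y)) \<in> borel_measurable lborel" for x
    by measurable
  show thesis
  proof
    have N_int: "integrable lborel N"
      unfolding N_def using lborel_pair.integrable_fst'[OF g2] .
    then show "integrable lebesgue N"
      by (subst integrable_completion) auto
    have "kernel_energy = (\<integral>p. (g p)\<^sup>2 \<partial>lebesgue)"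
      unfolding kernel_energy_def
      by (intro integral_cong_AE[OF _ _ sq_eq] borel_measurable_power kernel_measurable
          measurable_completion[OF g_lborel])
    also have "\<dots> = (\<integral>p. (g p)\<^sup>2 \<partial>lborel)"
      by (intro integral_completion borel_measurable_power g_lborel)
    also have "\<dots> = (\<integral>x. N x \<partial>lborel)"
      using lborel_pair.integral_fst'[OF g2] by (simp add: N_def lborel_prod)
    also have "\<dots> = (\<integral>x. N x \<partial>lebesgue)"
      using N_int by (intro integral_completion[symmetric]) auto
    finally show "(\<integral>x. N x \<partial>lebesgue) = kernel_energy" by simp
    show "AE x in lebesgue. K x \<in> borel_measurable lebesgue"
      using AE_completion[OF eq]
    proof eventually_elim
      case (elim x)
      show ?case
        using AE_completion[OF elim]
        by (intro borel_measurable_AE[OF measurable_completion[OF section_meas[of x]]])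
           (auto elim: eventually_mono)
    qed
    show "AE x in lebesgue. K x \<in> borel_measurable lebesgue \<longrightarrow>
       integrable lebesgue (\<lambda>y. (K x y)\<^sup>2) \<and> (\<integral>y. (K x y)\<^sup>2 \<partial>lebesgue) = N x"
      using AE_completion[OF eq] AE_completion[OF lborel_pair.AE_integrable_fst'[OF g2]]
    proof eventually_elim
      case (elim x)
      have sq [measurable]: "(\<lambda>y. (g (x, y))\<^sup>2) \<in> borel_measurable lborel"
        using section_meas[of x] by measurable
      have sq' [measurable]: "(\<lambda>y. (g (x, y))\<^sup>2) \<in> borel_measurable lebesgue"
        using measurable_completion[OF sq] .
      have ae: "AE y in lebesgue. (K x y)\<^sup>2 = (g (x, y))\<^sup>2"
        using AE_completion[OF elim(1)] by eventually_elim simp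
      show ?case
      proof
        assume [measurable]: "K x \<in> borel_measurable lebesgue"
        show "integrable lebesgue (\<lambda>y. (K x y)\<^sup>2) \<and> (\<integral>y. (K x y)\<^sup>2 \<partial>lebesgue) = N x"
          using elim(2) integral_cong_AE[OF _ sq' ae] integrable_cong_AE[OF _ sq' ae]
          by (simp add: integrable_completion integral_completion N_def)
      qed
    qed
  qed
qed

text \<open>
  An arbitrary section is, outside a null set, the pointwise limit of finite combinations of
  measurable sections: in the feature space it is projected onto the closed span of those.
\<close>

lemma section_measurable [measurable]: "K z \<in> borel_measurable lebesgue"
proof -
  \<comment> \<open>\<open>G\<close> has a double role: points of \<open>U n\<close> lie in
    \<open>G\<close>, so that \<open>u n\<close> is measurable, and test points lie in
    \<open>G\<close>, which gives convergence at almost every \<open>y\<close>.\<close>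
  define G where "G = {x. K x \<in> borel_measurable lebesgue}"
  have "(\<lambda>x. K x z) = K z" by (rule ext) (rule kernel_sym)
  then have "(lincomb u (K z))\<^sup>2 \<le> K z z * gram u u" for u
    using gram_Cauchy_Schwarz[of u "[(1, z)]"]
    by (simp add: gram_single gram_single' mult.commute)
  then obtain U where U: "\<And>n. snd ` set (U n) \<subseteq> G"
    "\<And>n v. snd ` set v \<subseteq> G \<Longrightarrow>
        (gram (U n) v - lincomb v (K z))\<^sup>2 \<le> 1 / real (Suc n) * gram v v"
    using approximate_representer[of G "K z" "K z z", OF _ diag_nonneg] by metis
  define u where "u n y = lincomb (U n) (\<lambda>x. K x y)" for n y
  have [measurable]: "u n \<in> borel_measurable lebesgue" for n
    unfolding u_def using U(1)[of n] by (intro borel_measurable_lincomb) (auto simp: G_def)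
  have lim: "(\<lambda>n. u n y) \<longlonglongrightarrow> K z y" if "y \<in> G" for y
  proof -
    have "(\<lambda>n. u n y - K z y) \<longlonglongrightarrow> 0"
      using U(2)[of "[(1, y)]"] that
      by (intro tendsto_zero_if_squares_le[where b = "K y y"])
         (simp add: u_def gram_single gram_single')
    then show ?thesis by (simp add: LIM_zero_iff)
  qed
  obtain N where "AE y in lebesgue. K y \<in> borel_measurable lebesgue"
    using AE_section_square_integrable by blast
  then have "AE y in lebesgue. lim (\<lambda>n. u n y) = K z y"
    by eventually_elim (rule limI[OF lim], simp add: G_def)
  \<comment> \<open>\<open>lim\<close> of measurable functions is measurable, whatever value it
    takes where convergence fails.\<close>
  moreover have "(\<lambda>y. lim (\<lambda>n. u n y)) \<in> borel_measurable lebesgue"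
    by measurable
  ultimately show ?thesis
    by (rule borel_measurable_AE[rotated])
qed

end

section \<open>Square integrability of every section\<close>

context square_integrable_psd_kernel
begin

text \<open>As \<open>y \<mapsto> K y y\<close> may fail to be measurable, \<open>E\<close> cannot
  be cut out by a bound on it. The condition \<open>hull\<close> replaces such a bound: a measurable
  property that follows from \<open>K y y \<le> m\<close> on the ball holds at almost every point of
  \<open>E\<close>.\<close>

lemma section_square_integral_le:
  fixes z :: 'a and m :: real and E :: "'a set"
  defines "f \<equiv> \<lambda>y. indicator E y * K z y"
  assumes [measurable]: "E \<in> sets lebesgue" and "E \<subseteq> cball 0 m" and "0 \<le> m"
    and section_le: "\<And>y. y \<in> E \<Longrightarrow> \<bar>K z y\<bar> \<le> m"
    and hull: "\<And>F. F \<in> sets lebesgue \<Longrightarrow> {y \<in> cball 0 m. K y y \<le> m} \<subseteq> F \<Longrightarrow>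
      AE y in lebesgue. y \<in> E \<longrightarrow> y \<in> F"
  shows "integrable lebesgue (\<lambda>y. (f y)\<^sup>2)"
    and "(\<integral>y. (f y)\<^sup>2 \<partial>lebesgue) \<le> K z z * sqrt kernel_energy"
proof -
  have [measurable]: "f \<in> borel_measurable lebesgue" unfolding f_def by measurable
  have "emeasure lebesgue E \<le> emeasure lebesgue (cball (0::'a) m)"
    using assms by (intro emeasure_mono) auto
  also have "\<dots> < \<infinity>" using emeasure_lborel_cball_finite by simp
  finally have E_fin: "emeasure lebesgue E < \<infinity>" .
  then have int_E: "integrable lebesgue (\<lambda>y. indicator E y * c)" for c :: real
    by (intro integrable_mult_left integrable_real_indicator) auto
  have f_le: "\<bar>f y\<bar> \<le> indicator E y * m" for y
    using section_le[of y] by (auto simp: f_def indicator_def)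
  show f_sq: "integrable lebesgue (\<lambda>y. (f y)\<^sup>2)"
  proof (rule Bochner_Integration.integrable_bound[OF int_E[of "m\<^sup>2"]])
    show "AE y in lebesgue. norm ((f y)\<^sup>2) \<le> norm (indicator E y * m\<^sup>2)"
    proof (rule AE_I2)
      fix y
      show "norm ((f y)\<^sup>2) \<le> norm (indicator E y * m\<^sup>2)"
        using power_mono[OF f_le[of y] abs_ge_zero, of 2]
        by (cases "y \<in> E") (auto simp: f_def)
    qed
  qed measurable
  define s where "s = (\<integral>y. (f y)\<^sup>2 \<partial>lebesgue)"
  have "0 \<le> s" by (simp add: s_def)

  define ev where "ev u y = lincomb u (\<lambda>x. K x y)" for u y
  have ev_gram: "ev u y = gram u [(1, y)]" for u y
    by (simp add: ev_def gram_single)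
  have [measurable]: "ev u \<in> borel_measurable lebesgue" for u
    unfolding ev_def by (intro borel_measurable_lincomb section_measurable)
  \<comment> \<open>By Cauchy-Schwarz the measurable set \<open>?F\<close> contains all points with
    \<open>K y y \<le> m\<close>, so \<open>hull\<close> applies to it. With \<open>c\<close> in
    place of \<open>gram u u\<close>, one majorant serves a whole sequence in the dominated
    convergence below.\<close>
  have ev_bound: "AE y in lebesgue. norm (f y * ev u y) \<le> indicator E y * (m * sqrt (c * m))"
    if c: "gram u u \<le> c" for u c
  proof -
    let ?F = "{y. (ev u y)\<^sup>2 \<le> c * m}"
    have "(ev u y)\<^sup>2 \<le> c * m" if "K y y \<le> m" for y
    proof -
      have "(ev u y)\<^sup>2 \<le> gram u u * K y y"
        using gram_Cauchy_Schwarz[of u "[(1, y)]"] by (simp add: ev_gram gram_single')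
      also have "\<dots> \<le> c * m"
        using c that gram_nonneg[of u] diag_nonneg[of y] by (intro mult_mono) auto
      finally show ?thesis .
    qed
    moreover have "?F \<in> sets lebesgue"
    proof -
      have "{y \<in> space lebesgue. (ev u y)\<^sup>2 \<le> c * m} \<in> sets lebesgue" by measurable
      then show ?thesis by simp
    qed
    ultimately have "AE y in lebesgue. y \<in> E \<longrightarrow> y \<in> ?F"
      by (intro hull) auto
    then show ?thesis
    proof eventually_elim
      case (elim y)
      show ?case
      proof (cases "y \<in> E")
        case True
        then have "\<bar>ev u y\<bar> \<le> sqrt (c * m)"
          using elim by (simp add: real_le_rsqrt)
        then have "\<bar>f y\<bar> * \<bar>ev u y\<bar> \<le> m * sqrt (c * m)"
          using f_le[of y] True \<open>0 \<le> m\<close> by (intro mult_mono) auto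
        then show ?thesis using True by (simp add: abs_mult)
      qed (simp add: f_def)
    qed
  qed
  have int_ev: "integrable lebesgue (\<lambda>y. f y * ev u y)" for u
  proof (rule Bochner_Integration.integrable_bound[OF int_E[of "m * sqrt (gram u u * m)"]])
    show "AE y in lebesgue. norm (f y * ev u y) \<le> norm (indicator E y * (m * sqrt (gram u u * m)))"
      using ev_bound[OF order_refl, of u] by eventually_elim (simp add: order_trans[OF _ abs_ge_self])
  qed measurable
  \<comment> \<open>\<open>\<tau>\<close> is the image of \<open>f\<close> under the integral
    operator. Its linear extension is the functional
    \<open>u \<mapsto> \<integral> f \<langle>u, \<Phi>\<rangle>\<close>.\<close>
  define \<tau> where "\<tau> x = (\<integral>y. f y * K x y \<partial>lebesgue)" for x
  have int_K: "integrable lebesgue (\<lambda>y. f y * K x y)" for x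
    using int_ev[of "[(1, x)]"] by (simp add: ev_def)
  have lincomb_\<tau>: "lincomb u \<tau> = (\<integral>y. f y * ev u y \<partial>lebesgue)" for u
  proof (induction u)
    case Nil
    then show ?case by (simp add: ev_def)
  next
    case (Cons p u)
    obtain a x where p: "p = (a, x)" by fastforce
    have "(\<integral>y. f y * ev (p # u) y \<partial>lebesgue) =
        (\<integral>y. a * (f y * K x y) + f y * ev u y \<partial>lebesgue)"
      by (simp add: p ev_def algebra_simps)
    also have "\<dots> = a * \<tau> x + lincomb u \<tau>"
      using int_K int_ev[of u] unfolding Cons by (simp add: \<tau>_def[of x])
    finally show ?case by (simp add: p)
  qed
  \<comment> \<open>The squared integral of the majorant, with the factor \<open>gram u u\<close>
    split off.\<close>
  define C where "C = (measure lebesgue E * m)\<^sup>2 * m"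
  have "0 \<le> C" using \<open>0 \<le> m\<close> by (simp add: C_def)
  have bounded: "(lincomb u \<tau>)\<^sup>2 \<le> C * gram u u" for u
  proof -
    have "\<bar>lincomb u \<tau>\<bar> \<le> (\<integral>y. norm (f y * ev u y) \<partial>lebesgue)"
      unfolding lincomb_\<tau> using integral_norm_bound[of lebesgue "\<lambda>y. f y * ev u y"] by simp
    also have "\<dots> \<le> (\<integral>y. indicator E y * (m * sqrt (gram u u * m)) \<partial>lebesgue)"
      by (intro integral_mono_AE integrable_norm int_ev int_E ev_bound order_refl)
    also have "\<dots> = measure lebesgue E * m * sqrt (gram u u * m)"
      by (simp add: mult.assoc)
    finally have "\<bar>lincomb u \<tau>\<bar>\<^sup>2 \<le> (measure lebesgue E * m * sqrt (gram u u * m))\<^sup>2"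
      by (intro power_mono) auto
    also have "\<dots> = C * gram u u"
      using gram_nonneg[of u] \<open>0 \<le> m\<close> by (simp add: C_def power_mult_distrib)
    finally show ?thesis by simp
  qed
  \<comment> \<open>The lists \<open>U n\<close> play the role of the vector
    \<open>\<integral> f(y) \<Phi>(y)\<close>. Evaluating them pointwise also exhibits
    \<open>\<tau>\<close> as a limit of measurable functions.\<close>
  obtain U where U: "\<And>n v. (gram (U n) v - lincomb v \<tau>)\<^sup>2 \<le> 1 / real (Suc n) * gram v v"
    using approximate_representer[of UNIV \<tau> C, OF bounded \<open>0 \<le> C\<close>] by auto
  have U_lim: "(\<lambda>n. gram (U n) v) \<longlonglongrightarrow> lincomb v \<tau>" for v
    using tendsto_zero_if_squares_le[OF U[of _ v]] by (simp add: LIM_zero_iff)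
  have ev_lim: "(\<lambda>n. ev (U n) y) \<longlonglongrightarrow> \<tau> y" for y
    using U_lim[of "[(1, y)]"] by (simp add: ev_gram)
  have \<tau>_meas [measurable]: "\<tau> \<in> borel_measurable lebesgue"
    by (rule borel_measurable_LIMSEQ_real[OF ev_lim]) measurable
  define q where "q n = gram (U n) (U n)" for n
  define T where "T n = lincomb (U n) \<tau>" for n
  have qT: "(q n - T n)\<^sup>2 \<le> 1 / real (Suc n) * q n" for n
    using U[of n "U n"] by (simp add: q_def T_def)
  have q_nonneg: "0 \<le> q n" for n using gram_nonneg by (simp add: q_def)
  \<comment> \<open>Here \<open>q\<^sup>2 \<le> 2 (q - T)\<^sup>2 + 2 T\<^sup>2 \<le> 2 q + 2 C
    q\<close>, and \<open>q\<close> cancels.\<close>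
  have q_le: "q n \<le> 2 + 2 * C" for n
  proof (rule ccontr)
    assume "\<not> q n \<le> 2 + 2 * C"
    then have "q n * (2 + 2 * C) < q n * q n"
      using \<open>0 \<le> C\<close> by (intro mult_strict_left_mono) auto
    moreover have "q n * q n \<le> 2 * (q n - T n)\<^sup>2 + 2 * (T n)\<^sup>2"
      using zero_le_power2[of "q n - 2 * T n"] by (simp add: power2_eq_square algebra_simps)
    moreover have "1 / real (Suc n) * q n \<le> q n"
      using q_nonneg[of n] by (simp add: divide_le_eq mult_left_le algebra_simps)
    moreover have "(T n)\<^sup>2 \<le> C * q n"
      using bounded[of "U n"] by (simp add: q_def T_def)
    ultimately show False using qT[of n] by (simp add: algebra_simps)
  qed
  \<comment> \<open>\<open>I\<close> is the double integral of \<open>f(x) K(x, y) f(y)\<close>, the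
    squared norm of the functional. Both \<open>T\<close> and \<open>q\<close> tend to it.\<close>
  define I where "I = (\<integral>y. f y * \<tau> y \<partial>lebesgue)"
  have "T \<longlonglongrightarrow> I"
    unfolding T_def lincomb_\<tau> I_def
  proof (rule integral_dominated_convergence[where w = "\<lambda>y. indicator E y * (m * sqrt ((2 + 2 * C) * m))"])
    show "AE y in lebesgue. (\<lambda>n. f y * ev (U n) y) \<longlonglongrightarrow> f y * \<tau> y"
      by (intro AE_I2 tendsto_mult tendsto_const ev_lim)
    show "AE y in lebesgue. norm (f y * ev (U n) y) \<le> indicator E y * (m * sqrt ((2 + 2 * C) * m))" for n
      using ev_bound[of "U n" "2 + 2 * C"] q_le[of n] by (simp add: q_def)
  qed (use int_E in \<open>measurable\<close>)
  moreover have "(\<lambda>n. q n - T n) \<longlonglongrightarrow> 0"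
  proof (rule tendsto_zero_if_squares_le)
    show "(q n - T n)\<^sup>2 \<le> 1 / real (Suc n) * (2 + 2 * C)" for n
      using qT[of n] mult_left_mono[OF q_le[of n], of "1 / real (Suc n)"] by simp
  qed
  ultimately have "(\<lambda>n. (q n - T n) + T n) \<longlonglongrightarrow> 0 + I"
    by (intro tendsto_add)
  then have q_lim: "q \<longlonglongrightarrow> I" by simp
  \<comment> \<open>Since \<open>f\<close> is \<open>K z\<close> cut off to \<open>E\<close>,
    \<open>f * K z\<close> equals the square of \<open>f\<close>: the functional at
    \<open>\<Phi>(z)\<close> returns the squared norm of \<open>f\<close>.\<close>
  have "\<tau> z = s"
    by (auto simp: \<tau>_def s_def f_def power2_eq_square indicator_def intro!: Bochner_Integration.integral_cong)
  then have "(\<lambda>n. gram (U n) [(1, z)]) \<longlonglongrightarrow> s"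
    using U_lim[of "[(1, z)]"] by simp
  then have s2_lim: "(\<lambda>n. (gram (U n) [(1, z)])\<^sup>2) \<longlonglongrightarrow> s\<^sup>2"
    by (rule tendsto_power)
  have qK_lim: "(\<lambda>n. q n * K z z) \<longlonglongrightarrow> I * K z z"
    by (intro tendsto_mult q_lim tendsto_const)
  have "(gram (U n) [(1, z)])\<^sup>2 \<le> q n * K z z" for n
    using gram_Cauchy_Schwarz[of "U n" "[(1, z)]"] by (simp add: q_def gram_single')
  then have s_I: "s\<^sup>2 \<le> I * K z z"
    using LIMSEQ_le[OF s2_lim qK_lim] by blast

  obtain N where N: "integrable lebesgue N" "(\<integral>x. N x \<partial>lebesgue) = kernel_energy"
    and "AE x in lebesgue. K x \<in> borel_measurable lebesgue"
    and AE_N: "AE x in lebesgue. K x \<in> borel_measurable lebesgue \<longrightarrow>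
      integrable lebesgue (\<lambda>y. (K x y)\<^sup>2) \<and> (\<integral>y. (K x y)\<^sup>2 \<partial>lebesgue) = N x"
    by (rule AE_section_square_integrable)
  \<comment> \<open>Hilbert-Schmidt bound: Cauchy-Schwarz in \<open>y\<close> for almost every
    \<open>x\<close>, followed by integration over \<open>x\<close>.\<close>
  have \<tau>_le: "AE x in lebesgue. (\<tau> x)\<^sup>2 \<le> s * N x"
    using AE_N
  proof eventually_elim
    case (elim x)
    then show ?case
      using Cauchy_Schwarz_integral[of f lebesgue "K x"] f_sq by (simp add: \<tau>_def s_def)
  qed
  have \<tau>_sq: "integrable lebesgue (\<lambda>x. (\<tau> x)\<^sup>2)"
  proof (rule Bochner_Integration.integrable_bound)
    show "integrable lebesgue (\<lambda>x. s * N x)" using N by simp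
    show "AE x in lebesgue. norm ((\<tau> x)\<^sup>2) \<le> norm (s * N x)"
      using \<tau>_le by eventually_elim (simp add: abs_of_nonneg)
  qed measurable
  have "(\<integral>x. (\<tau> x)\<^sup>2 \<partial>lebesgue) \<le> (\<integral>x. s * N x \<partial>lebesgue)"
    using N \<tau>_le \<tau>_sq by (intro integral_mono_AE) auto
  then have \<tau>_int: "(\<integral>x. (\<tau> x)\<^sup>2 \<partial>lebesgue) \<le> s * kernel_energy"
    using N by simp
  \<comment> \<open>The norms of \<open>f\<close> and \<open>\<tau>\<close> both contribute a factor
    \<open>sqrt s\<close>, so the bound on \<open>I\<close> is linear in \<open>s\<close>. In
    \<open>s_I\<close> one factor \<open>s\<close> then cancels.\<close>
  have "I\<^sup>2 \<le> s * (\<integral>x. (\<tau> x)\<^sup>2 \<partial>lebesgue)"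
    using Cauchy_Schwarz_integral[of f lebesgue \<tau>] f_sq \<tau>_sq by (simp add: I_def s_def)
  also have "\<dots> \<le> s * (s * kernel_energy)"
    using \<tau>_int \<open>0 \<le> s\<close> by (rule mult_left_mono)
  also have "\<dots> = (s * sqrt kernel_energy)\<^sup>2"
    using kernel_energy_nonneg by (simp add: power2_eq_square algebra_simps)
  finally have "I \<le> s * sqrt kernel_energy"
    using \<open>0 \<le> s\<close> kernel_energy_nonneg by (auto intro: power2_le_imp_le[of I])
  then have "s * s \<le> s * (K z z * sqrt kernel_energy)"
    using s_I mult_right_mono[of I "s * sqrt kernel_energy" "K z z"] diag_nonneg[of z]
    by (simp add: power2_eq_square algebra_simps)
  then show "s \<le> K z z * sqrt kernel_energy"
    using \<open>0 \<le> s\<close> diag_nonneg[of z] kernel_energy_nonneg by (cases "s = 0") auto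
qed

end

text \<open>\<open>B\<close> is a measurable superset whose measure is the outer measure of
  \<open>A\<close>. As \<open>B \<inter> F\<close> still contains \<open>A\<close>, it has full
  measure in \<open>B\<close>. Cutting with the ball keeps measures finite, so that they can be
  subtracted.\<close>

lemma measurable_hull_bounded:
  fixes A :: "'a::euclidean_space set"
  assumes "A \<subseteq> cball 0 m"
  obtains B where "B \<in> sets lebesgue" "A \<subseteq> B" "B \<subseteq> cball 0 m"
    "\<And>F. F \<in> sets lebesgue \<Longrightarrow> A \<subseteq> F \<Longrightarrow> AE y in lebesgue. y \<in> B \<longrightarrow> y \<in> F"
proof -
  obtain B0 where B0: "B0 \<in> sets lebesgue" "A \<subseteq> B0"
    "outer_measure_of lebesgue A = emeasure lebesgue B0"
    using outer_measure_of_attain[of A lebesgue] by auto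
  define B where "B = B0 \<inter> cball 0 m"
  have B [measurable]: "B \<in> sets lebesgue" "A \<subseteq> B" using B0 assms by (auto simp: B_def)
  have minimal: "emeasure lebesgue B \<le> emeasure lebesgue F"
    if "F \<in> sets lebesgue" "A \<subseteq> F" for F
  proof -
    have "emeasure lebesgue B \<le> outer_measure_of lebesgue A"
      unfolding B0(3) using B0(1) by (intro emeasure_mono) (auto simp: B_def)
    also have "\<dots> \<le> emeasure lebesgue F"
      using outer_measure_of_mono[OF that(2), of lebesgue] that(1) by simp
    finally show ?thesis .
  qed
  have "emeasure lebesgue B \<le> emeasure lebesgue (cball (0::'a) m)"
    by (intro emeasure_mono) (auto simp: B_def)
  also have "\<dots> < \<infinity>" using emeasure_lborel_cball_finite by simp
  finally have fin: "emeasure lebesgue B < \<infinity>" .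
  show thesis
  proof
    fix F :: "'a set" assume [measurable]: "F \<in> sets lebesgue" and "A \<subseteq> F"
    have "emeasure lebesgue (B - B \<inter> F) = emeasure lebesgue B - emeasure lebesgue (B \<inter> F)"
      using fin emeasure_mono[of "B \<inter> F" B lebesgue] by (intro emeasure_Diff) auto
    also have "\<dots> = 0"
      using minimal[of "B \<inter> F"] B \<open>A \<subseteq> F\<close> fin by (intro diff_eq_0_ennreal) auto
    finally have "B - B \<inter> F \<in> null_sets lebesgue" by (intro null_setsI) auto
    then show "AE y in lebesgue. y \<in> B \<longrightarrow> y \<in> F"
      by (rule AE_I') auto
  qed (use B in \<open>auto simp: B_def\<close>)
qed

context square_integrable_psd_kernel
begin

text \<open>Monotone convergence along sets \<open>E m\<close> that exhaust the space, with a bound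
  independent of \<open>m\<close>.\<close>

lemma section_square_integrable: "integrable lebesgue (\<lambda>y. (K z y)\<^sup>2)"
proof -
  define A where "A m = {y \<in> cball 0 (real m). K y y \<le> real m}" for m :: nat
  have "\<exists>B. B \<in> sets lebesgue \<and> A m \<subseteq> B \<and> B \<subseteq> cball 0 (real m) \<and>
      (\<forall>F\<in>sets lebesgue. A m \<subseteq> F \<longrightarrow> (AE y in lebesgue. y \<in> B \<longrightarrow> y \<in> F))" for m
    by (rule measurable_hull_bounded[of "A m" "real m"]) (auto simp: A_def)
  then obtain B where B [measurable]: "\<And>m. B m \<in> sets lebesgue" and AB: "\<And>m. A m \<subseteq> B m"
    and B_cball: "\<And>m. B m \<subseteq> cball 0 (real m)"
    and hull: "\<And>m F. F \<in> sets lebesgue \<Longrightarrow> A m \<subseteq> F \<Longrightarrow> AE y in lebesgue. y \<in> B m \<longrightarrow> y \<in> F"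
    by metis
  \<comment> \<open>Hulls of the increasing sets \<open>A m\<close> need not increase. Intersecting
    over all \<open>j \<ge> m\<close> restores monotonicity, keeps the points of \<open>A m\<close>
    at which \<open>K z\<close> is at most \<open>m\<close> in absolute value, and stays inside
    \<open>B m\<close>, so \<open>hull\<close> is inherited.\<close>
  define E where "E m = (\<Inter>j\<in>{m..}. B j) \<inter> {y. \<bar>K z y\<bar> \<le> real m}" for m :: nat
  have K_level: "{y. \<bar>K z y\<bar> \<le> real m} \<in> sets lebesgue" for m :: nat
  proof -
    have "{y \<in> space lebesgue. \<bar>K z y\<bar> \<le> real m} \<in> sets lebesgue" by measurable
    then show ?thesis by simp
  qed
  have E_meas [measurable]: "E m \<in> sets lebesgue" for m
    unfolding E_def by (intro sets.Int sets.countable_INT'' K_level) auto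
  have E_mono: "E m \<subseteq> E n" if "m \<le> n" for m n
    using that by (force simp: E_def)
  have A_mono: "A m \<subseteq> A n" if "m \<le> n" for m n
    using that by (force simp: A_def)
  have E_UN: "\<exists>m. y \<in> E m" for y
  proof -
    obtain m :: nat where m: "max (norm y) (max (K y y) \<bar>K z y\<bar>) \<le> real m"
      using real_arch_simple by blast
    then have "y \<in> A m" by (simp add: A_def)
    then have "y \<in> B j" if "m \<le> j" for j using A_mono[OF that] AB by blast
    with m show ?thesis by (auto simp: E_def)
  qed
  let ?f = "\<lambda>m y. indicator (E m) y * K z y" and ?c = "K z z * sqrt kernel_energy"
  have f: "integrable lebesgue (\<lambda>y. (?f m y)\<^sup>2)" "(\<integral>y. (?f m y)\<^sup>2 \<partial>lebesgue) \<le> ?c" for m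
  proof -
    have sub: "E m \<subseteq> B m" by (auto simp: E_def)
    have *: "AE y in lebesgue. y \<in> E m \<longrightarrow> y \<in> F"
      if F: "F \<in> sets lebesgue" "{y \<in> cball 0 (real m). K y y \<le> real m} \<subseteq> F" for F
      using hull[OF F(1), of m] F(2) sub unfolding A_def by (auto elim: eventually_mono)
    have **: "E m \<subseteq> cball 0 (real m)" "\<And>y. y \<in> E m \<Longrightarrow> \<bar>K z y\<bar> \<le> real m"
      using sub B_cball[of m] by (auto simp: E_def)
    show "integrable lebesgue (\<lambda>y. (?f m y)\<^sup>2)" "(\<integral>y. (?f m y)\<^sup>2 \<partial>lebesgue) \<le> ?c"
      using section_square_integral_le[OF E_meas **(1) _ **(2) *] by auto
  qed
  have lim: "(SUP m. ennreal ((?f m y)\<^sup>2)) = ennreal ((K z y)\<^sup>2)" for y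
  proof (rule antisym)
    show "(SUP m. ennreal ((?f m y)\<^sup>2)) \<le> ennreal ((K z y)\<^sup>2)"
      by (intro SUP_least ennreal_leI) (auto simp: indicator_def)
    obtain m where "y \<in> E m" using E_UN by blast
    then show "ennreal ((K z y)\<^sup>2) \<le> (SUP m. ennreal ((?f m y)\<^sup>2))"
      by (intro SUP_upper2[of m]) auto
  qed
  have inc: "incseq (\<lambda>m y. ennreal ((?f m y)\<^sup>2))"
    using E_mono by (force simp: incseq_def le_fun_def indicator_def intro!: ennreal_leI)
  have "(\<integral>\<^sup>+y. ennreal ((K z y)\<^sup>2) \<partial>lebesgue) = (\<integral>\<^sup>+y. (SUP m. ennreal ((?f m y)\<^sup>2)) \<partial>lebesgue)"
    by (simp only: lim)
  also have "\<dots> = (SUP m. \<integral>\<^sup>+y. ennreal ((?f m y)\<^sup>2) \<partial>lebesgue)"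
    by (rule nn_integral_monotone_convergence_SUP[OF inc]) measurable
  also have "\<dots> \<le> ennreal ?c"
    using f by (intro SUP_least) (simp add: nn_integral_eq_integral ennreal_leI)
  finally have "(\<integral>\<^sup>+y. ennreal ((K z y)\<^sup>2) \<partial>lebesgue) < \<infinity>"
    by (rule le_less_trans) simp
  then show ?thesis
    by (intro integrableI_bounded) auto
qed

end

section \<open>Square integrable functions on a subset\<close>

lemma L2_iff:
  fixes A :: "'a::euclidean_space set"
  assumes "A \<in> sets lebesgue" and f: "f \<in> extensional A"
  shows "f \<in> L2 A \<longleftrightarrow> (\<lambda>x. if x \<in> A then f x else 0) \<in> borel_measurable lebesgue \<and>
    integrable lebesgue (\<lambda>x. (if x \<in> A then f x else 0)\<^sup>2)"
proof -
  have "(\<lambda>x. (if x \<in> A then f x else 0)\<^sup>2) = (\<lambda>x. if x \<in> A then (f x)\<^sup>2 else 0)"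
    by auto
  then show ?thesis
    using assms by (simp add: L2_def borel_measurable_if Lebesgue_Measure.integrable_restrict_UNIV)
qed

lemma L2_extensional: "f \<in> L2 A \<Longrightarrow> f \<in> extensional A"
  by (simp add: L2_def)

lemma zero_L2: "(\<lambda>x\<in>A. 0) \<in> L2 A"
proof -
  have "(\<lambda>x\<in>A. 0 :: real) \<in> borel_measurable (lebesgue_on A)"
    by (rule measurable_cong[THEN iffD1, of _ "\<lambda>x. 0"]) simp_all
  moreover have "integrable (lebesgue_on A) (\<lambda>x. ((\<lambda>x\<in>A. 0 :: real) x)\<^sup>2)"
    by (rule Bochner_Integration.integrable_cong[THEN iffD1, of _ _ "\<lambda>x. 0"]) simp_all
  ultimately show ?thesis by (simp add: L2_def)
qed

lemma L2_add_scaled: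
  assumes "f \<in> L2 A" "g \<in> L2 A"
  shows "(\<lambda>x\<in>A. f x + c * g x) \<in> L2 A"
proof -
  have m [measurable]: "f \<in> borel_measurable (lebesgue_on A)" "g \<in> borel_measurable (lebesgue_on A)"
    and i: "integrable (lebesgue_on A) (\<lambda>x. (f x)\<^sup>2)" "integrable (lebesgue_on A) (\<lambda>x. (g x)\<^sup>2)"
    using assms by (auto simp: L2_def)
  have "integrable (lebesgue_on A) (\<lambda>x. (f x)\<^sup>2 + 2 * c * (f x * g x) + c\<^sup>2 * (g x)\<^sup>2)"
    using i integrable_mult_square_integrable[OF m i] by simp
  moreover have "(\<lambda>x. (f x)\<^sup>2 + 2 * c * (f x * g x) + c\<^sup>2 * (g x)\<^sup>2) = (\<lambda>x. (f x + c * g x)\<^sup>2)"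
    by (auto simp: power2_eq_square algebra_simps)
  ultimately have sq: "integrable (lebesgue_on A) (\<lambda>x. (f x + c * g x)\<^sup>2)" by simp
  have "(\<lambda>x. f x + c * g x) \<in> borel_measurable (lebesgue_on A)" by measurable
  then have "(\<lambda>x\<in>A. f x + c * g x) \<in> borel_measurable (lebesgue_on A)"
    by (rule measurable_cong[THEN iffD1, rotated]) simp
  moreover have "integrable (lebesgue_on A) (\<lambda>x. ((\<lambda>x\<in>A. f x + c * g x) x)\<^sup>2)"
    by (rule Bochner_Integration.integrable_cong[THEN iffD1, OF refl _ sq]) simp
  ultimately show ?thesis by (simp add: L2_def)
qed

text \<open>Extending \<open>k\<close> by zero keeps symmetry and semidefiniteness, because points
  outside \<open>A\<close> contribute nothing to the quadratic form. The results on whole-space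
  kernels then apply.\<close>

lemma kernel_section_L2:
  fixes A :: "'a::euclidean_space set"
  assumes A: "A \<in> sets borel" and sym: "symmetric_kernel A k" and psd: "pos_semidef_kernel A k"
    and k: "(\<lambda>(x, y)\<in>A \<times> A. k x y) \<in> L2 (A \<times> A)" and "z \<in> A"
  shows "(\<lambda>y\<in>A. k z y) \<in> L2 A"
proof -
  define K where "K x y = (if x \<in> A \<and> y \<in> A then k x y else 0)" for x y
  have AA: "A \<times> A \<in> sets lebesgue"
    using A borel_Times[of A A] by (intro sets_completionI_sets) simp
  have K_eq: "(\<lambda>p. if p \<in> A \<times> A then (\<lambda>(x, y)\<in>A \<times> A. k x y) p else 0) = (\<lambda>p. K (fst p) (snd p))"
    by (auto simp: K_def fun_eq_iff)
  interpret square_integrable_psd_kernel K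
  proof
    show "symmetric_kernel UNIV K"
      using sym by (auto simp: symmetric_kernel_def K_def)
    show "pos_semidef_kernel UNIV K"
      unfolding pos_semidef_kernel_def
    proof (intro allI impI)
      fix S :: "'a set" and c assume "finite S"
      have "(\<Sum>x\<in>S. \<Sum>y\<in>S. c x * c y * K x y) = (\<Sum>x\<in>S \<inter> A. \<Sum>y\<in>S. c x * c y * K x y)"
        using \<open>finite S\<close> by (intro sum.mono_neutral_right) (auto simp: K_def)
      also have "\<dots> = (\<Sum>x\<in>S \<inter> A. \<Sum>y\<in>S \<inter> A. c x * c y * K x y)"
        using \<open>finite S\<close> by (intro sum.cong refl sum.mono_neutral_right) (auto simp: K_def)
      also have "\<dots> = (\<Sum>x\<in>S \<inter> A. \<Sum>y\<in>S \<inter> A. c x * c y * k x y)"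
        by (intro sum.cong refl) (auto simp: K_def)
      also have "\<dots> \<ge> 0"
        using psd \<open>finite S\<close> unfolding pos_semidef_kernel_def by simp
      finally show "0 \<le> (\<Sum>x\<in>S. \<Sum>y\<in>S. c x * c y * K x y)" .
    qed
    show "(\<lambda>p. K (fst p) (snd p)) \<in> borel_measurable lebesgue"
      "integrable lebesgue (\<lambda>p. (K (fst p) (snd p))\<^sup>2)"
      using k L2_iff[OF AA L2_extensional[OF k]] by (simp_all only: K_eq fun_cong[OF K_eq])
  qed
  have eq: "(\<lambda>y. if y \<in> A then (\<lambda>y\<in>A. k z y) y else 0) = K z"
    using \<open>z \<in> A\<close> by (auto simp: K_def fun_eq_iff)
  have "A \<in> sets lebesgue" using A by simp
  then show ?thesis
    using section_measurable[of z] section_square_integrable[of z]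
    by (subst L2_iff) (simp_all only: eq fun_cong[OF eq] restrict_extensional simp_thms)
qed

subsection \<open>Measures carried by a finite set\<close>

text \<open>Points of \<open>P\<close> may have mass zero, so one set can serve \<alpha>, \<beta>
  and their mixture at once.\<close>

definition carried_by :: "'a measure \<Rightarrow> 'a set \<Rightarrow> bool" where
  "carried_by M P \<longleftrightarrow> finite P \<and> P \<subseteq> space M \<and> (\<forall>x\<in>P. {x} \<in> sets M) \<and>
     emeasure M (space M - P) = 0"

lemma carried_by_sets: "carried_by M P \<Longrightarrow> P \<in> sets M"
  unfolding carried_by_def using sets.finite_UN[of P "\<lambda>x. {x}" M] by simp

text \<open>Every function is measurable for the completion: off \<open>P\<close> a preimage lies in
  a null set, on \<open>P\<close> it is a finite union of singletons. Almost everywhere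
  \<open>h\<close> agrees with a simple function supported on \<open>P\<close>.\<close>

lemma expect_carried_by:
  assumes "finite_measure M" and P: "carried_by M P"
  shows "expect M h = (\<Sum>x\<in>P. measure M {x} * h x)"
proof -
  interpret finite_measure M by fact
  have fin: "finite P" and sing: "\<And>x. x \<in> P \<Longrightarrow> {x} \<in> sets M"
    using P by (auto simp: carried_by_def)
  have "space M - P \<in> null_sets M"
    using P carried_by_sets[OF P] by (intro null_setsI) (auto simp: carried_by_def)
  then have ae: "AE x in M. x \<in> P"
    by (rule AE_I') auto
  have h_meas: "h \<in> borel_measurable (completion M)"
  proof (rule measurableI)
    fix B :: "real set" assume "B \<in> sets borel"
    have "AE x in M. \<not> (x \<notin> P \<and> h x \<in> B)" using ae by eventually_elim simp
    from sets_completion_AE[OF this]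
    have "{x \<in> space M. x \<notin> P \<and> h x \<in> B} \<in> sets (completion M)"
      by (simp add: pred_def)
    moreover have "(\<Union>x\<in>P \<inter> h -` B. {x}) \<in> sets (completion M)"
      using fin sing by (intro sets.finite_UN) auto
    moreover have "h -` B \<inter> space (completion M) =
        {x \<in> space M. x \<notin> P \<and> h x \<in> B} \<union> (\<Union>x\<in>P \<inter> h -` B. {x})"
      using P by (auto simp: carried_by_def)
    ultimately show "h -` B \<inter> space (completion M) \<in> sets (completion M)"
      by simp
  qed simp
  have simple_meas: "(\<lambda>x. \<Sum>p\<in>P. indicator {p} x * h p) \<in> borel_measurable M"
    using sing by (intro borel_measurable_sum borel_measurable_times borel_measurable_indicator) auto
  have "expect M h = (\<integral>x. (\<Sum>p\<in>P. indicator {p} x * h p) \<partial>(completion M))"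
    unfolding expect_def
  proof (rule integral_cong_AE[OF h_meas measurable_completion[OF simple_meas]])
    show "AE x in completion M. h x = (\<Sum>p\<in>P. indicator {p} x * h p)"
      using AE_completion[OF ae]
    proof eventually_elim
      case (elim x)
      have "(\<Sum>p\<in>P. indicator {p} x * h p) = (\<Sum>p\<in>P. if p = x then h p else 0)"
        by (intro sum.cong) (auto simp: indicator_def)
      then show ?case using elim fin by simp
    qed
  qed
  also have "\<dots> = (\<integral>x. (\<Sum>p\<in>P. indicator {p} x * h p) \<partial>M)"
    by (rule integral_completion[OF simple_meas])
  also have "\<dots> = (\<Sum>p\<in>P. \<integral>x. indicator {p} x * h p \<partial>M)"
    using sing by (intro Bochner_Integration.integral_sum integrable_mult_left integrable_real_indicator)
      (auto simp: less_top[symmetric])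
  also have "\<dots> = (\<Sum>p\<in>P. measure M {p} * h p)"
    using sing sets.sets_into_space by (intro sum.cong) (auto simp: Int_absorb2)
  finally show ?thesis .
qed

lemma carried_by_pair:
  assumes M: "carried_by M P" and N: "carried_by N Q" and "sigma_finite_measure N"
  shows "carried_by (M \<Otimes>\<^sub>M N) (P \<times> Q)"
proof -
  interpret sigma_finite_measure N by fact
  have [measurable]: "P \<in> sets M" "Q \<in> sets N" using M N by (auto dest: carried_by_sets)
  have "emeasure (M \<Otimes>\<^sub>M N) (space (M \<Otimes>\<^sub>M N) - P \<times> Q) \<le>
      emeasure (M \<Otimes>\<^sub>M N) ((space M - P) \<times> space N \<union> space M \<times> (space N - Q))"
    by (intro emeasure_mono) (auto simp: space_pair_measure)
  also have "\<dots> \<le> emeasure (M \<Otimes>\<^sub>M N) ((space M - P) \<times> space N) +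
      emeasure (M \<Otimes>\<^sub>M N) (space M \<times> (space N - Q))"
    by (intro emeasure_subadditive) auto
  also have "\<dots> = 0"
    using M N by (simp add: emeasure_pair_measure_Times carried_by_def)
  finally have null: "emeasure (M \<Otimes>\<^sub>M N) (space (M \<Otimes>\<^sub>M N) - P \<times> Q) = 0" by simp
  have "{(x, y)} \<in> sets (M \<Otimes>\<^sub>M N)" if "x \<in> P" "y \<in> Q" for x y
    using pair_measureI[of "{x}" M "{y}" N] M N that by (simp add: carried_by_def)
  then show ?thesis
    using M N null by (auto simp: carried_by_def space_pair_measure)
qed

text \<open>The expectation is over the completion of the product measure, so the formula for finite
  carriers is applied to the product itself rather than to iterated integrals.\<close>

lemma expect_pair_carried_by:
  assumes "prob_space M" "prob_space N" and M: "carried_by M P" and N: "carried_by N Q"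
  shows "expect (M \<Otimes>\<^sub>M N) (\<lambda>(x, y). h x y) =
    (\<Sum>x\<in>P. \<Sum>y\<in>Q. measure M {x} * measure N {y} * h x y)"
proof -
  interpret M: prob_space M by fact
  interpret N: prob_space N by fact
  interpret pair_prob_space M N ..
  have "measure (M \<Otimes>\<^sub>M N) {(x, y)} = measure M {x} * measure N {y}" if "x \<in> P" "y \<in> Q" for x y
    using M N that N.emeasure_pair_measure_Times[of "{x}" M "{y}"]
    by (simp add: carried_by_def measure_def enn2real_mult)
  then show ?thesis
    using expect_carried_by[OF finite_measure_axioms carried_by_pair[OF M N N.sigma_finite_measure_axioms]]
    by (simp add: sum.cartesian_product) (auto intro!: sum.cong)
qed

section \<open>The mixture and its support\<close>

lemma
  assumes sets_eq: "sets \<beta> = sets \<alpha>"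
  shows sets_half_mixture: "sets (half_mixture \<alpha> \<beta>) = sets \<alpha>"
    and space_half_mixture: "space (half_mixture \<alpha> \<beta>) = space \<alpha>"
    and emeasure_half_mixture: "A \<in> sets \<alpha> \<Longrightarrow>
      emeasure (half_mixture \<alpha> \<beta>) A = (1/2) * emeasure \<alpha> A + (1/2) * emeasure \<beta> A"
proof -
  let ?\<mu> = "\<lambda>A. (1/2) * emeasure \<alpha> A + (1/2) * emeasure \<beta> A"
  show "sets (half_mixture \<alpha> \<beta>) = sets \<alpha>" "space (half_mixture \<alpha> \<beta>) = space \<alpha>"
    by (simp_all add: half_mixture_def sets.space_closed)
  assume A: "A \<in> sets \<alpha>"
  show "emeasure (half_mixture \<alpha> \<beta>) A = ?\<mu> A"
    unfolding half_mixture_def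
  proof (rule emeasure_measure_of_sigma)
    show "sigma_algebra (space \<alpha>) (sets \<alpha>)" by (rule sets.sigma_algebra_axioms)
    show "positive (sets \<alpha>) ?\<mu>" by (simp add: positive_def)
    show "countably_additive (sets \<alpha>) ?\<mu>"
    proof (rule countably_additiveI)
      fix F :: "nat \<Rightarrow> 'a set"
      assume F: "range F \<subseteq> sets \<alpha>" "disjoint_family F"
      have "(\<Sum>i. ?\<mu> (F i)) = (1/2) * (\<Sum>i. emeasure \<alpha> (F i)) + (1/2) * (\<Sum>i. emeasure \<beta> (F i))"
        by (simp add: suminf_add[symmetric] ennreal_suminf_cmult)
      also have "\<dots> = ?\<mu> (\<Union>i. F i)"
        using F sets_eq by (simp add: suminf_emeasure)
      finally show "(\<Sum>i. ?\<mu> (F i)) = ?\<mu> (\<Union>i. F i)" .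
    qed
  qed (rule A)
qed

text \<open>The topological support is the set of points of positive mass, because finite sets are
  closed. What remains of the space is null.\<close>

lemma carried_by_supp:
  fixes \<mu> :: "'a::t1_space measure"
  assumes \<mu>: "finite_dirac_mixture \<mu>" and sets: "sets \<mu> = sets (restrict_space borel A)"
  shows "carried_by \<mu> (supp \<mu>)" and "x \<in> supp \<mu> \<Longrightarrow> 0 < emeasure \<mu> {x}"
proof -
  have space: "space \<mu> = A"
    using sets_eq_imp_space_eq[OF sets] by (simp add: space_restrict_space)
  have finite_sets: "F \<in> sets \<mu>" if "finite F" "F \<subseteq> A" for F
    unfolding sets sets_restrict_space
    using that by (intro image_eqI[of _ _ F]) (auto intro: borel_closed finite_imp_closed)
  obtain S w where S: "finite S" "S \<subseteq> A" and
    em: "\<And>B. B \<in> sets \<mu> \<Longrightarrow> emeasure \<mu> B = (\<Sum>x\<in>S. ennreal (w x) * emeasure (return \<mu> x) B)"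
    using \<mu> unfolding finite_dirac_mixture_def space by blast
  have S_sets: "A - S \<in> sets \<mu>"
    using sets.compl_sets[OF finite_sets[OF S]] space by simp
  then have null: "emeasure \<mu> (A - S) = 0"
    by (simp add: em)
  have pos: "0 < emeasure \<mu> {x}" if x: "x \<in> supp \<mu>" for x
  proof -
    have "x \<in> A" using x space by (simp add: supp_def)
    \<comment> \<open>A neighbourhood of \<open>x\<close> that avoids all other atoms: its mass can
      only come from \<open>x\<close>.\<close>
    have "open (- (S - {x}))"
      using S(1) by (intro open_Compl finite_imp_closed) auto
    then have "0 < emeasure \<mu> (- (S - {x}) \<inter> A)"
      using x by (auto simp: supp_def space)
    also have "\<dots> \<le> emeasure \<mu> ({x} \<union> (A - S))"
      using \<open>x \<in> A\<close> S_sets finite_sets[of "{x}"] by (intro emeasure_mono sets.Un) auto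
    also have "\<dots> \<le> emeasure \<mu> {x} + emeasure \<mu> (A - S)"
      using \<open>x \<in> A\<close> S_sets finite_sets[of "{x}"] by (intro emeasure_subadditive) auto
    finally show ?thesis using null by simp
  qed
  then show "x \<in> supp \<mu> \<Longrightarrow> 0 < emeasure \<mu> {x}" .
  have in_supp: "x \<in> supp \<mu>" if x: "x \<in> A" "0 < emeasure \<mu> {x}" for x
    unfolding supp_def space
  proof (intro CollectI conjI allI impI x(1))
    fix U :: "'a set" assume U: "open U" "x \<in> U"
    then have "U \<inter> A \<in> sets \<mu>"
      unfolding sets sets_restrict_space by (auto intro!: image_eqI[of _ _ U])
    then have "emeasure \<mu> {x} \<le> emeasure \<mu> (U \<inter> A)"
      using U x by (intro emeasure_mono) auto
    then show "0 < emeasure \<mu> (U \<inter> A)" using x(2) by simp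
  qed
  have supp_A: "supp \<mu> \<subseteq> A" using space by (auto simp: supp_def)
  have supp_S: "supp \<mu> \<subseteq> S"
  proof
    fix x assume x: "x \<in> supp \<mu>"
    show "x \<in> S"
    proof (rule ccontr)
      assume "x \<notin> S"
      then have "emeasure \<mu> {x} \<le> emeasure \<mu> (A - S)"
        using x supp_A S_sets by (intro emeasure_mono) auto
      then show False using pos[OF x] null by simp
    qed
  qed
  \<comment> \<open>Weights in the mixture may vanish, so \<open>S\<close> can exceed the support by
    finitely many null points.\<close>
  have "(\<Union>x\<in>S - supp \<mu>. {x}) \<in> null_sets \<mu>"
    using S in_supp
    by (intro null_sets_UN' countable_finite null_setsI)
       (auto simp: zero_less_iff_neq_zero intro: finite_sets)
  then have "(A - S) \<union> (S - supp \<mu>) \<in> null_sets \<mu>"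
    using null S_sets by (intro null_sets.Un null_setsI) auto
  moreover have "(A - S) \<union> (S - supp \<mu>) = A - supp \<mu>"
    using supp_S S(2) by auto
  ultimately have "emeasure \<mu> (A - supp \<mu>) = 0" by auto
  then show "carried_by \<mu> (supp \<mu>)"
    using supp_A finite_subset[OF supp_S S(1)]
    by (auto simp: carried_by_def space intro!: finite_sets)
qed

subsection \<open>The flow\<close>

text \<open>For a linear functional the difference quotient is constant in
  \<open>\<epsilon> \<noteq> 0\<close>, and the gradient is the density of its coefficients
  \<open>c\<close> with respect to the masses \<open>m\<close>.\<close>

lemma L2_gradient_discrete:
  fixes F :: "'a::topological_space \<Rightarrow> real" and c m :: "'a \<Rightarrow> real"
  assumes "finite (supp \<mu>)"
    and inner: "\<And>g h. L2_inner \<mu> g h = (\<Sum>x\<in>supp \<mu>. m x * (g x * h x))"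
    and L: "\<And>h. L h = (\<Sum>x\<in>supp \<mu>. c x * h x)"
    and pos: "\<And>x. x \<in> supp \<mu> \<Longrightarrow> 0 < m x"
  shows "L2_gradient \<mu> L F = (\<lambda>x\<in>supp \<mu>. c x / m x)"
proof -
  let ?P = "supp \<mu>" and ?g = "\<lambda>x\<in>supp \<mu>. c x / m x"
  have lim: "((\<lambda>\<epsilon>. (1 / \<epsilon>) * (L (\<lambda>x\<in>?P. F x + \<epsilon> * \<psi> x) - L F)) \<longlongrightarrow> L2_inner \<mu> ?g \<psi>) (at 0)" for \<psi>
  proof (rule tendsto_eventually)
    have "(1 / \<epsilon>) * (L (\<lambda>x\<in>?P. F x + \<epsilon> * \<psi> x) - L F) = L2_inner \<mu> ?g \<psi>" if "\<epsilon> \<noteq> 0" for \<epsilon>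
    proof -
      have "L (\<lambda>x\<in>?P. F x + \<epsilon> * \<psi> x) - L F = \<epsilon> * (\<Sum>x\<in>?P. c x * \<psi> x)"
        by (simp add: L sum_subtractf[symmetric] sum_distrib_left algebra_simps)
      moreover have "L2_inner \<mu> ?g \<psi> = (\<Sum>x\<in>?P. c x * \<psi> x)"
        unfolding inner using pos by (intro sum.cong refl) (simp add: less_imp_neq[symmetric])
      ultimately show ?thesis using that by simp
    qed
    then show "\<forall>\<^sub>F \<epsilon> in at 0. (1 / \<epsilon>) * (L (\<lambda>x\<in>?P. F x + \<epsilon> * \<psi> x) - L F) = L2_inner \<mu> ?g \<psi>"
      by (auto simp: eventually_at_filter)
  qed
  show ?thesis
    unfolding L2_gradient_def
  proof (rule the_equality)
    show "?g \<in> L2_discrete \<mu> \<and> (\<forall>\<psi>\<in>L2_discrete \<mu>.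
        ((\<lambda>\<epsilon>. (1 / \<epsilon>) * (L (\<lambda>x\<in>?P. F x + \<epsilon> * \<psi> x) - L F)) \<longlongrightarrow> L2_inner \<mu> ?g \<psi>) (at 0))"
      using lim by (simp add: L2_discrete_def)
    fix g assume g: "g \<in> L2_discrete \<mu> \<and> (\<forall>\<psi>\<in>L2_discrete \<mu>.
        ((\<lambda>\<epsilon>. (1 / \<epsilon>) * (L (\<lambda>x\<in>?P. F x + \<epsilon> * \<psi> x) - L F)) \<longlongrightarrow> L2_inner \<mu> g \<psi>) (at 0))"
    show "g = ?g"
    proof (rule extensionalityI)
      show "g \<in> extensional ?P" using g by (simp add: L2_discrete_def)
      fix x assume x: "x \<in> ?P"
      \<comment> \<open>Testing with the indicator of a point reads off \<open>m x * g x\<close>. As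
        \<open>m x\<close> is positive, this determines \<open>g x\<close>.\<close>
      define \<psi> :: "'a \<Rightarrow> real" where "\<psi> = (\<lambda>y\<in>?P. if y = x then 1 else 0)"
      have "\<psi> \<in> L2_discrete \<mu>" by (simp add: \<psi>_def L2_discrete_def)
      then have "L2_inner \<mu> g \<psi> = L2_inner \<mu> ?g \<psi>"
        using tendsto_unique[OF _ _ lim[of \<psi>]] g by auto
      moreover have "L2_inner \<mu> f \<psi> = m x * f x" for f
      proof -
        have "L2_inner \<mu> f \<psi> = (\<Sum>y\<in>?P. if y = x then m y * f y else 0)"
          unfolding inner \<psi>_def by (intro sum.cong) auto
        then show ?thesis using x \<open>finite ?P\<close> by simp
      qed
      ultimately show "g x = ?g x" using pos[OF x] by simp
    qed simp
  qed
qed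

theorem proposition4:
  fixes \<Omega> :: "(real ^ 'n) set"
    and \<alpha> \<beta> :: "(real ^ 'n) measure"
    and k :: "real ^ 'n \<Rightarrow> real ^ 'n \<Rightarrow> real"
  assumes "closed \<Omega>" and "convex \<Omega>"
    and "distribution_on \<Omega> \<alpha>" and "distribution_on \<Omega> \<beta>"
    and "finite_dirac_mixture (half_mixture \<alpha> \<beta>)"
    and "symmetric_kernel \<Omega> k" and "pos_semidef_kernel \<Omega> k"
    and "(\<lambda>(x, y)\<in>\<Omega> \<times> \<Omega>. k x y) \<in> L2 (\<Omega> \<times> \<Omega>)"
  shows "\<forall>f. (kernel_flow_solution \<Omega> k (half_mixture \<alpha> \<beta>) (ipm_loss \<alpha> \<beta>) f \<longleftrightarrow>
               f 0 \<in> L2 \<Omega> \<and> (\<forall>t\<ge>0. f t = (\<lambda>x\<in>\<Omega>. f 0 x + t * mmd_witness \<Omega> k \<alpha> \<beta> x))) \<and>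
             (kernel_flow_solution \<Omega> k (half_mixture \<alpha> \<beta>) (ipm_loss \<alpha> \<beta>) f \<longrightarrow>
               (\<forall>t\<ge>0. ipm_loss \<alpha> \<beta> (f t) = ipm_loss \<alpha> \<beta> (f 0) + t * mmd_squared k \<alpha> \<beta>))"
proof -
  let ?\<gamma> = "half_mixture \<alpha> \<beta>" and ?w = "mmd_witness \<Omega> k \<alpha> \<beta>"
  define P where "P = supp ?\<gamma>"
  define a where "a x = measure \<alpha> {x}" for x
  define b where "b x = measure \<beta> {x}" for x
  interpret \<alpha>: prob_space \<alpha> using assms(3) by (simp add: distribution_on_def)
  interpret \<beta>: prob_space \<beta> using assms(4) by (simp add: distribution_on_def)
  have sets: "sets \<alpha> = sets (restrict_space borel \<Omega>)" "sets \<beta> = sets \<alpha>"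
    using assms(3,4) by (simp_all add: distribution_on_def)
  have space: "space \<alpha> = \<Omega>" "space \<beta> = \<Omega>"
    using sets_eq_imp_space_eq[OF sets(1)] sets_eq_imp_space_eq[OF sets(2)]
    by (simp_all add: space_restrict_space)
  note mix = sets_half_mixture[OF sets(2)] space_half_mixture[OF sets(2)]
    emeasure_half_mixture[OF sets(2)]
  have "sets ?\<gamma> = sets (restrict_space borel \<Omega>)" using mix(1) sets(1) by simp
  note supp = carried_by_supp[OF assms(5) this, folded P_def]
  have P: "finite P" "P \<subseteq> \<Omega>" and sing: "\<And>x. x \<in> P \<Longrightarrow> {x} \<in> sets \<alpha>"
    using supp(1) by (auto simp: carried_by_def mix space)
  have "P \<in> sets \<alpha>" using carried_by_sets[OF supp(1)] mix by simp
  then have "\<Omega> - P \<in> sets \<alpha>" using sets.compl_sets space by metis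
  moreover have "emeasure ?\<gamma> (\<Omega> - P) = 0" using supp(1) by (simp add: carried_by_def mix space)
  \<comment> \<open>A null set of the mixture is null for both components, so \<alpha> and \<beta>
    live on the support of the mixture.\<close>
  ultimately have "emeasure \<alpha> (\<Omega> - P) = 0" "emeasure \<beta> (\<Omega> - P) = 0"
    by (simp_all add: mix)
  then have carried: "carried_by \<alpha> P" "carried_by \<beta> P"
    using P sing sets(2) by (auto simp: carried_by_def space)
  have "finite_measure ?\<gamma>"
  proof
    have "emeasure ?\<gamma> (space ?\<gamma>) < \<infinity>"
      unfolding mix(2) mix(3)[OF sets.top]
      using \<alpha>.emeasure_space_1 \<beta>.emeasure_space_1 space
      by (simp add: less_top[symmetric] ennreal_divide_eq_top_iff)
    then show "emeasure ?\<gamma> (space ?\<gamma>) \<noteq> \<infinity>" by simp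
  qed
  then interpret \<gamma>: finite_measure ?\<gamma> .
  note expect_\<alpha> = expect_carried_by[OF \<alpha>.finite_measure_axioms carried(1), folded a_def]
    and expect_\<beta> = expect_carried_by[OF \<beta>.finite_measure_axioms carried(2), folded b_def]
    and expect_\<gamma> = expect_carried_by[OF \<gamma>.finite_measure_axioms supp(1)]
  have m_pos: "0 < measure ?\<gamma> {x}" if "x \<in> P" for x
    using supp(2)[OF that] \<gamma>.emeasure_eq_measure by simp
  have loss: "ipm_loss \<alpha> \<beta> h = (\<Sum>x\<in>P. (a x - b x) * h x)" for h
    by (simp add: ipm_loss_def expect_\<alpha> expect_\<beta> sum_subtractf left_diff_distrib)
  \<comment> \<open>The density of the signed measure \<alpha> - \<beta> with respect to the
    mixture, the same for every \<open>F\<close>.\<close>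
  have grad: "L2_gradient ?\<gamma> (ipm_loss \<alpha> \<beta>) F = (\<lambda>x\<in>P. (a x - b x) / measure ?\<gamma> {x})" for F
    unfolding P_def
    by (rule L2_gradient_discrete)
       (use P loss m_pos in \<open>simp_all add: P_def[symmetric] L2_inner_def expect_\<gamma>\<close>)
  have sym: "k x y = k y x" if "x \<in> \<Omega>" "y \<in> \<Omega>" for x y
    using assms(6) that by (simp add: symmetric_kernel_def)
  have witness: "?w = (\<lambda>z\<in>\<Omega>. \<Sum>x\<in>P. (a x - b x) * k x z)"
    by (simp add: mmd_witness_def expect_\<alpha> expect_\<beta> sum_subtractf left_diff_distrib cong: restrict_cong)
  \<comment> \<open>The masses of the mixture cancel against the denominators of the gradient.
    Symmetry exchanges the arguments of \<open>k\<close>.\<close>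
  have drift: "kernel_operator \<Omega> k ?\<gamma> (L2_gradient ?\<gamma> (ipm_loss \<alpha> \<beta>) F) z = ?w z"
    if "z \<in> \<Omega>" for F z
  proof -
    have "(\<Sum>x\<in>P. measure ?\<gamma> {x} * (k z x * ((a x - b x) / measure ?\<gamma> {x}))) =
        (\<Sum>x\<in>P. (a x - b x) * k x z)"
    proof (rule sum.cong[OF refl])
      fix x assume x: "x \<in> P"
      then have "k z x = k x z" using sym that P(2) by blast
      then show "measure ?\<gamma> {x} * (k z x * ((a x - b x) / measure ?\<gamma> {x})) = (a x - b x) * k x z"
        using m_pos[OF x] by simp
    qed
    then show ?thesis
      using that by (simp add: kernel_operator_def grad expect_\<gamma> witness)
  qed
  have "\<Omega> \<in> sets borel" using assms(1) by simp
  note section_L2 = kernel_section_L2[OF this assms(6-8)]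
  have w_L2: "?w \<in> L2 \<Omega>"
  proof -
    \<comment> \<open>The witness is a finite combination of sections at prescribed atoms, added one
      at a time. This is where square integrability of each single section is used.\<close>
    have "(\<lambda>z\<in>\<Omega>. \<Sum>x\<in>Q. (a x - b x) * k x z) \<in> L2 \<Omega>" if "finite Q" "Q \<subseteq> \<Omega>" for Q
      using that
    proof (induction Q)
      case empty
      show ?case by (simp only: sum.empty zero_L2)
    next
      case (insert x Q)
      have "(\<lambda>z\<in>\<Omega>. \<Sum>x\<in>insert x Q. (a x - b x) * k x z) =
          (\<lambda>z\<in>\<Omega>. (\<lambda>z\<in>\<Omega>. \<Sum>x\<in>Q. (a x - b x) * k x z) z + (a x - b x) * (\<lambda>z\<in>\<Omega>. k x z) z)"
        using insert.hyps by (auto simp: fun_eq_iff)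
      then show ?case
        using L2_add_scaled[OF insert.IH section_L2[of x], of "a x - b x"] insert.prems
        by (simp only: insert_subset)
    qed
    then show ?thesis using P by (simp add: witness)
  qed
  \<comment> \<open>Expanding the product of \<open>a - b\<close> with itself gives four double
    sums, and symmetry of \<open>k\<close> identifies the two mixed ones.\<close>
  have mmd: "ipm_loss \<alpha> \<beta> ?w = mmd_squared k \<alpha> \<beta>"
  proof -
    let ?s = "\<lambda>u v. \<Sum>x\<in>P. \<Sum>y\<in>P. u x * v y * k x y"
    have expand: "ipm_loss \<alpha> \<beta> ?w = ?s a a - ?s a b - ?s b a + ?s b b"
    proof -
      have "ipm_loss \<alpha> \<beta> ?w = (\<Sum>y\<in>P. \<Sum>x\<in>P. (a y - b y) * ((a x - b x) * k x y))"
        unfolding loss using P(2) by (intro sum.cong refl) (auto simp: witness sum_distrib_left)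
      also have "\<dots> = (\<Sum>x\<in>P. \<Sum>y\<in>P. (a y - b y) * ((a x - b x) * k x y))"
        by (rule sum.swap)
      also have "\<dots> = ?s a a - ?s a b - ?s b a + ?s b b"
        by (simp add: sum_subtractf[symmetric] sum.distrib[symmetric] algebra_simps)
      finally show ?thesis .
    qed
    have "?s b a = ?s a b"
    proof -
      have "?s b a = (\<Sum>y\<in>P. \<Sum>x\<in>P. b x * a y * k x y)" by (rule sum.swap)
      also have "\<dots> = ?s a b"
        using P(2) sym by (intro sum.cong refl) (auto simp: mult.commute)
      finally show ?thesis .
    qed
    moreover
    note pair_expect = expect_pair_carried_by[OF \<alpha>.prob_space_axioms \<alpha>.prob_space_axioms carried(1,1)]
      expect_pair_carried_by[OF \<alpha>.prob_space_axioms \<beta>.prob_space_axioms carried]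
      expect_pair_carried_by[OF \<beta>.prob_space_axioms \<beta>.prob_space_axioms carried(2,2)]
    have "mmd_squared k \<alpha> \<beta> = ?s a a - 2 * ?s a b + ?s b b"
      unfolding mmd_squared_def pair_expect a_def b_def ..
    ultimately show ?thesis using expand by simp
  qed
  have solution: "kernel_flow_solution \<Omega> k ?\<gamma> (ipm_loss \<alpha> \<beta>) f \<longleftrightarrow>
      (\<forall>t\<ge>0. f t \<in> L2 \<Omega>) \<and>
      (\<forall>t\<ge>0. \<forall>x\<in>\<Omega>. ((\<lambda>s. f s x) has_real_derivative ?w x) (at t within {0..}))" for f
    by (simp add: kernel_flow_solution_def drift)
  have iff: "kernel_flow_solution \<Omega> k ?\<gamma> (ipm_loss \<alpha> \<beta>) f \<longleftrightarrow>
      f 0 \<in> L2 \<Omega> \<and> (\<forall>t\<ge>0. f t = (\<lambda>x\<in>\<Omega>. f 0 x + t * ?w x))" for f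
  proof
    assume "kernel_flow_solution \<Omega> k ?\<gamma> (ipm_loss \<alpha> \<beta>) f"
    then have f_L2: "\<And>t. 0 \<le> t \<Longrightarrow> f t \<in> L2 \<Omega>"
      and deriv: "\<And>t x. 0 \<le> t \<Longrightarrow> x \<in> \<Omega> \<Longrightarrow>
        ((\<lambda>s. f s x) has_real_derivative ?w x) (at t within {0..})"
      by (auto simp: solution)
    have pointwise: "f t x = f 0 x + t * ?w x" if t: "0 \<le> t" and x: "x \<in> \<Omega>" for t x
    proof -
      \<comment> \<open>For fixed \<open>x\<close> the difference from the line has zero derivative
        on the convex set \<open>{0..}\<close>, one-sided at 0, and is therefore constant.\<close>
      have "((\<lambda>s. f s x - s * ?w x) has_real_derivative 0) (at s within {0..})" if "s \<in> {0..}" for s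
        using DERIV_diff[OF deriv[OF _ x, of s] DERIV_cmult_right[OF DERIV_ident, of "?w x"]] that
        by simp
      then have "\<exists>c. \<forall>s\<in>{0..}. f s x - s * ?w x = c"
        by (intro has_field_derivative_zero_constant) simp_all
      then obtain c where c: "\<forall>s\<in>{0..}. f s x - s * ?w x = c" ..
      from bspec[OF c, of t] bspec[OF c, of 0] show ?thesis using t by simp
    qed
    \<comment> \<open>Outside \<Omega> both sides are \<open>undefined\<close>, by
      extensionality.\<close>
    have "f t = (\<lambda>x\<in>\<Omega>. f 0 x + t * ?w x)" if "0 \<le> t" for t
    proof (rule extensionalityI[OF L2_extensional[OF f_L2[OF that]] restrict_extensional])
      show "f t x = (\<lambda>x\<in>\<Omega>. f 0 x + t * ?w x) x" if "x \<in> \<Omega>" for x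
        using pointwise[OF \<open>0 \<le> t\<close> that] that by (simp only: restrict_apply if_True)
    qed
    then show "f 0 \<in> L2 \<Omega> \<and> (\<forall>t\<ge>0. f t = (\<lambda>x\<in>\<Omega>. f 0 x + t * ?w x))"
      using f_L2 by blast
  next
    assume f: "f 0 \<in> L2 \<Omega> \<and> (\<forall>t\<ge>0. f t = (\<lambda>x\<in>\<Omega>. f 0 x + t * ?w x))"
    then have line: "f t = (\<lambda>x\<in>\<Omega>. f 0 x + t * ?w x)" if "0 \<le> t" for t
      using that by blast
    have "((\<lambda>s. f s x) has_real_derivative ?w x) (at t within {0..})"
      if t: "0 \<le> t" and x: "x \<in> \<Omega>" for t x
    \<comment> \<open>The formula for \<open>f\<close> holds at nonnegative times only, so the
      derivative is transferred within \<open>{0..}\<close>; any radius would do.\<close>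
    proof (rule has_field_derivative_transform_within[where d = 1])
      show "((\<lambda>s. f 0 x + s * ?w x) has_real_derivative ?w x) (at t within {0..})"
        by (auto intro!: derivative_eq_intros)
      show "f 0 x + s * ?w x = f s x" if "s \<in> {0..}" for s
        using fun_cong[OF line, of s x] that x by (simp only: restrict_apply if_True atLeast_iff)
    qed (use t in auto)
    moreover have "f t \<in> L2 \<Omega>" if "0 \<le> t" for t
      unfolding line[OF that] using f L2_add_scaled[OF _ w_L2] by blast
    ultimately show "kernel_flow_solution \<Omega> k ?\<gamma> (ipm_loss \<alpha> \<beta>) f"
      unfolding solution by blast
  qed
  have "ipm_loss \<alpha> \<beta> (f t) = ipm_loss \<alpha> \<beta> (f 0) + t * mmd_squared k \<alpha> \<beta>"
    if "kernel_flow_solution \<Omega> k ?\<gamma> (ipm_loss \<alpha> \<beta>) f" "0 \<le> t" for f t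
  proof -
    have "f t = (\<lambda>x\<in>\<Omega>. f 0 x + t * ?w x)" using that iff by blast
    then have "ipm_loss \<alpha> \<beta> (f t) = (\<Sum>x\<in>P. (a x - b x) * (f 0 x + t * ?w x))"
      unfolding loss using P(2) by (intro sum.cong refl) auto
    also have "\<dots> = ipm_loss \<alpha> \<beta> (f 0) + t * ipm_loss \<alpha> \<beta> ?w"
      unfolding loss sum_distrib_left sum.distrib[symmetric]
      by (intro sum.cong) (simp_all add: algebra_simps)
    finally show ?thesis by (simp add: mmd)
  qed
  with iff show ?thesis by blast
qed

end
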